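(* Let $(M,\omega,\mathcal{L},\nabla)$ be a prequantum system. The operators $\nabla, \nabla^\Lambda, \Lambda, L, H$ give a representation of the superalgebra $\mathfrak{osp}(1|2)$ on the complex of twisted differential forms $\Omega^*(M,\mathcal{L})$.
   Context: A prequantum system is a quadruple $(M,\omega,\mathcal{L},\nabla)$ where $(M^{2m},\omega)$ is a compact connected symplectic manifold of dimension $2m$ and $\mathcal{L}\to M$ is a hermitian complex line bundle with unitary connection $\nabla$ of curvature $\omega$, normalized so that the induced operator $\nabla:\Omega^*(M,\mathcal{L})\to\Omega^{*+1}(M,\mathcal{L})$ on $\mathcal{L}$-valued forms satisfies $\nabla^2=-i\,\omega\wedge$. Operators on $\Omega^*(M,\mathcal{L})$: $L=\omega\wedge$; $\Lambda$ is interior product with the Poisson bivector field associated to $\omega$, with sign convention $\Lambda=\tfrac12\sum_{i,j}(\omega^{-1})^{ij}\iota_{\partial_i}\iota_{\partial_j}$ (so $\Lambda=\sum_i \iota_{\partial_{y_i}}\iota_{\partial_{x_i}}$ in Darboux coordinates $\omega=\sum_i dx_i\wedge dy_i$); $H$ is defined by $H|_{\Omega^k(M,\mathcal{L})}=(m-k)\cdot 1$; and $\nabla^\Lambda=[\nabla,\Lambda]=\nabla\Lambda-\Lambda\nabla$. The operators $L,\Lambda,H$ are even; $\nabla,\nabla^\Lambda$ are odd, and the superbracket of operators is the anticommutator $\{A,B\}=AB+BA$ on two odd operators and the commutator otherwise. The superalgebra $\mathfrak{osp}(1|2)$ has even part $\mathfrak{sl}(2)$ and odd part its two-dimensional standard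 representation (dimension $3|2$). The assertion is understood up to normalization, i.e. up to rescaling the operators by nonzero complex constants, so that they satisfy the standard relations of the generators of $\mathfrak{osp}(1|2)$, with the even part represented by $L,\Lambda,H$. *)

theory Defs
  imports "HOL-Analysis.Analysis" "HOL-Library.Function_Algebras"
begin

section \<open>Complex vector spaces\<close>

class complex_vector = real_vector +
  fixes scaleC :: "complex \<Rightarrow> 'a \<Rightarrow> 'a"  (infixr "*\<^sub>C" 75)
  assumes scaleC_add_right: "z *\<^sub>C (x + y) = z *\<^sub>C x + z *\<^sub>C y"
    and scaleC_add_left: "(z + w) *\<^sub>C x = z *\<^sub>C x + w *\<^sub>C x"
    and scaleC_scaleC: "z *\<^sub>C (w *\<^sub>C x) = (z * w) *\<^sub>C x"
    and scaleR_scaleC: "r *\<^sub>R x = complex_of_real r *\<^sub>C x"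


section \<open>Smooth maps between open subsets of normed spaces\<close>

primrec C_diff_on :: "nat \<Rightarrow> 'a::real_normed_vector set \<Rightarrow> ('a \<Rightarrow> 'b::real_normed_vector) \<Rightarrow> bool"
where
  "C_diff_on 0 S f \<longleftrightarrow> continuous_on S f"
| "C_diff_on (Suc n) S f \<longleftrightarrow>
     (\<forall>x\<in>S. f differentiable (at x)) \<and>
     (\<forall>v. C_diff_on n S (\<lambda>x. frechet_derivative f (at x) v))"

definition smooth_on :: "'a::real_normed_vector set \<Rightarrow> ('a \<Rightarrow> 'b::real_normed_vector) \<Rightarrow> bool" where
  "smooth_on S f \<longleftrightarrow> (\<forall>n. C_diff_on n S f)"


section \<open>Smooth manifolds\<close>

text \<open>The points of the manifold are the elements of a Hausdorff space \<open>'m\<close>; the model space is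
  \<open>real ^ 'n\<close>. A chart is a pair of a domain and a map; the values of the map outside the domain are
  irrelevant.\<close>

type_synonym ('m, 'n) chart = "'m set \<times> ('m \<Rightarrow> real ^ 'n)"

abbreviation chart_inv :: "('m, 'n::finite) chart \<Rightarrow> real ^ 'n \<Rightarrow> 'm" where
  "chart_inv c \<equiv> inv_into (fst c) (snd c)"

definition is_chart :: "('m::t2_space, 'n::finite) chart \<Rightarrow> bool" where
  "is_chart c \<longleftrightarrow> open (fst c) \<and> open (snd c ` fst c) \<and>
     homeomorphism (fst c) (snd c ` fst c) (snd c) (chart_inv c)"

definition smooth_atlas :: "('m::t2_space, 'n::finite) chart set \<Rightarrow> bool" where
  "smooth_atlas A \<longleftrightarrow>
     (\<forall>c\<in>A. is_chart c) \<and> (\<Union>c\<in>A. fst c) = UNIV \<and>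
     (\<forall>c\<in>A. \<forall>c'\<in>A. smooth_on (snd c ` (fst c \<inter> fst c')) (snd c' \<circ> chart_inv c))"

definition smooth_fun_on ::
  "('m::t2_space, 'n::finite) chart set \<Rightarrow> 'm set \<Rightarrow> ('m \<Rightarrow> 'v::real_normed_vector) \<Rightarrow> bool" where
  "smooth_fun_on A V f \<longleftrightarrow> (\<forall>c\<in>A. smooth_on (snd c ` (fst c \<inter> V)) (f \<circ> chart_inv c))"

text \<open>A tangent vector at \<open>p\<close> is the family of its components in the charts around \<open>p\<close>, transforming by
  the derivatives of the transition maps; it is normalized to 0 at all other charts, so that
  tangent vectors are equal iff their components are.\<close>

type_synonym ('m, 'n) tangent = "('m, 'n) chart \<Rightarrow> real ^ 'n"

definition tangent_space ::
  "('m::t2_space, 'n::finite) chart set \<Rightarrow> 'm \<Rightarrow> ('m, 'n) tangent set" where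
  "tangent_space A p = {v.
     (\<forall>c\<in>A. \<forall>c'\<in>A. p \<in> fst c \<inter> fst c' \<longrightarrow>
        v c' = frechet_derivative (snd c' \<circ> chart_inv c) (at (snd c p)) (v c)) \<and>
     (\<forall>c. \<not> (c \<in> A \<and> p \<in> fst c) \<longrightarrow> v c = 0)}"

definition coord_vector ::
  "('m::t2_space, 'n::finite) chart set \<Rightarrow> ('m, 'n) chart \<Rightarrow> real ^ 'n \<Rightarrow> 'm \<Rightarrow> ('m, 'n) tangent"
where \<comment> \<open>the vector at \<open>p\<close> with components \<open>e\<close> in the chart \<open>c\<close>\<close>
  "coord_vector A c e p = (\<lambda>c'. if c' \<in> A \<and> p \<in> fst c'
     then frechet_derivative (snd c' \<circ> chart_inv c) (at (snd c p)) e else 0)"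

definition chart_at :: "('m::t2_space, 'n::finite) chart set \<Rightarrow> 'm \<Rightarrow> ('m, 'n) chart" where
  "chart_at A p = (SOME c. c \<in> A \<and> p \<in> fst c)"


section \<open>Differential forms\<close>

text \<open>A differential form of mixed degree is a function of a point and a list of tangent vectors; its
  component of degree \<open>k\<close> is its restriction to lists of length \<open>k\<close>. Forms vanish, by convention, on
  lists that contain anything but tangent vectors at the point.\<close>

type_synonym ('m, 'n, 'v) form = "'m \<Rightarrow> ('m, 'n) tangent list \<Rightarrow> 'v"

definition alternating_at ::
  "('m::t2_space, 'n::finite) chart set \<Rightarrow> 'm \<Rightarrow> (('m, 'n) tangent list \<Rightarrow> 'v::real_vector) \<Rightarrow> bool"
where
  "alternating_at A p f \<longleftrightarrow>
     (\<forall>vs. \<not> set vs \<subseteq> tangent_space A p \<longrightarrow> f vs = 0) \<and>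
     (\<forall>vs i u w. set vs \<subseteq> tangent_space A p \<and> i < length vs \<and>
          u \<in> tangent_space A p \<and> w \<in> tangent_space A p \<longrightarrow>
        f (vs[i := \<lambda>c. u c + w c]) = f (vs[i := u]) + f (vs[i := w])) \<and>
     (\<forall>vs i u a. set vs \<subseteq> tangent_space A p \<and> i < length vs \<and> u \<in> tangent_space A p \<longrightarrow>
        f (vs[i := \<lambda>c. a *\<^sub>R u c]) = a *\<^sub>R f (vs[i := u])) \<and>
     (\<forall>vs i j. set vs \<subseteq> tangent_space A p \<and> i < j \<and> j < length vs \<and> vs ! i = vs ! j \<longrightarrow>
        f vs = 0)"

definition smooth_form_on ::
  "('m::t2_space, 'n::finite) chart set \<Rightarrow> 'm set \<Rightarrow> ('m, 'n, 'v::real_normed_vector) form \<Rightarrow> bool"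
where
  "smooth_form_on A V \<alpha> \<longleftrightarrow> (\<forall>c\<in>A. \<forall>es. smooth_on (snd c ` (fst c \<inter> V))
     ((\<lambda>p. \<alpha> p (map (\<lambda>e. coord_vector A c e p) es)) \<circ> chart_inv c))"

definition forms ::
  "('m::t2_space, 'n::finite) chart set \<Rightarrow> ('m, 'n, 'v::real_normed_vector) form set" where
  "forms A = {\<alpha>. (\<forall>p. alternating_at A p (\<alpha> p)) \<and> smooth_form_on A UNIV \<alpha>}"

definition of_degree :: "nat \<Rightarrow> ('m, 'n, 'v::zero) form set" where
  "of_degree k = {\<alpha>. \<forall>p vs. length vs \<noteq> k \<longrightarrow> \<alpha> p vs = 0}"

definition zero_form :: "('m \<Rightarrow> 'v::zero) \<Rightarrow> ('m, 'n, 'v) form" where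
  "zero_form f = (\<lambda>p vs. if vs = [] then f p else 0)"

text \<open>The exterior derivative, computed at each point in some chart around it:
  \[(d\alpha)(v_0,\ldots,v_k) = \sum_i (-1)^i \partial_{v_i} \alpha(v_0,\ldots,\widehat{v_i},\ldots,v_k)\]
  for constant coordinate vector fields; for smooth forms the result does not depend on the chart.\<close>

definition ext_deriv :: "('m::t2_space, 'n::finite) chart set \<Rightarrow>
    ('m, 'n, 'v::real_normed_vector) form \<Rightarrow> ('m, 'n, 'v) form" where
  "ext_deriv A \<alpha> = (\<lambda>p vs. if set vs \<subseteq> tangent_space A p then
     (let c = chart_at A p in
      \<Sum>i<length vs. (-1) ^ i *\<^sub>R frechet_derivative
        ((\<lambda>q. \<alpha> q (map (\<lambda>v. coord_vector A c (v c) q) (nths vs (- {i})))) \<circ> chart_inv c)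
        (at (snd c p)) ((vs ! i) c))
     else 0)"

text \<open>The wedge product as a sum over shuffles (no factorials): a shuffle of a list is given by the set
  \<open>S\<close> of positions that go to the first factor, and its sign is determined by the number of inversions.\<close>

definition wedge ::
  "('m, 'n, real) form \<Rightarrow> ('m, 'n, 'v::real_vector) form \<Rightarrow> ('m, 'n, 'v) form" where
  "wedge \<alpha> \<psi> = (\<lambda>p vs. \<Sum>S\<in>Pow {..<length vs}.
     ((-1) ^ card {(i, j). i \<in> S \<and> j \<in> {..<length vs} - S \<and> j < i} * \<alpha> p (nths vs S))
       *\<^sub>R \<psi> p (nths vs (- S)))"

definition interior_product ::
  "('m \<Rightarrow> ('m, 'n) tangent) \<Rightarrow> ('m, 'n, 'v) form \<Rightarrow> ('m, 'n, 'v) form" where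
  "interior_product X \<psi> = (\<lambda>p vs. \<psi> p (X p # vs))"

definition symplectic_form ::
  "('m::t2_space, 'n::finite) chart set \<Rightarrow> ('m, 'n, real) form \<Rightarrow> bool" where
  "symplectic_form A \<omega> \<longleftrightarrow> \<omega> \<in> forms A \<inter> of_degree 2 \<and> ext_deriv A \<omega> = 0 \<and>
     (\<forall>p. \<forall>v\<in>tangent_space A p. (\<forall>w\<in>tangent_space A p. \<omega> p [v, w] = 0) \<longrightarrow> v = 0)"


section \<open>Hermitian line bundles and unitary connections\<close>

text \<open>The fibre over \<open>p\<close> is a complex line \<open>E p\<close>; for convenience all fibres are linear subspaces of one
  complex vector space \<open>'f\<close>. This space is arbitrary (for instance the direct sum of the fibres),
  carries no topology, and plays no other role: the bundle structure is given by the
  local trivializations \<open>(V, \<tau>)\<close>, where \<open>\<tau> p\<close> maps \<open>E p\<close> isomorphically to the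
  complex numbers for \<open>p \<in> V\<close>.\<close>

type_synonym ('m, 'f) trivialization = "'m set \<times> ('m \<Rightarrow> 'f \<Rightarrow> complex)"

definition local_frame :: "('m \<Rightarrow> 'f set) \<Rightarrow> ('m, 'f) trivialization \<Rightarrow> 'm \<Rightarrow> 'f" where
  "local_frame E t p = inv_into (E p) (snd t p) 1"

definition complex_line_bundle :: "('m::t2_space, 'n::finite) chart set \<Rightarrow>
    ('m \<Rightarrow> 'f::complex_vector set) \<Rightarrow> ('m, 'f) trivialization set \<Rightarrow> bool" where
  "complex_line_bundle A E T \<longleftrightarrow>
     (\<forall>p. \<exists>e. e \<noteq> 0 \<and> E p = range (\<lambda>z. z *\<^sub>C e)) \<and>
     (\<Union>t\<in>T. fst t) = UNIV \<and>
     (\<forall>t\<in>T. open (fst t) \<and> (\<forall>p\<in>fst t. bij_betw (snd t p) (E p) UNIV \<and>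
        (\<forall>u\<in>E p. \<forall>w\<in>E p. snd t p (u + w) = snd t p u + snd t p w) \<and>
        (\<forall>u\<in>E p. \<forall>z. snd t p (z *\<^sub>C u) = z * snd t p u))) \<and>
     (\<forall>t\<in>T. \<forall>t'\<in>T. smooth_fun_on A (fst t \<inter> fst t') (\<lambda>p. snd t' p (local_frame E t p)))"

definition hermitian_metric :: "('m::t2_space, 'n::finite) chart set \<Rightarrow>
    ('m \<Rightarrow> 'f::complex_vector set) \<Rightarrow> ('m, 'f) trivialization set \<Rightarrow>
    ('m \<Rightarrow> 'f \<Rightarrow> 'f \<Rightarrow> complex) \<Rightarrow> bool" where
  "hermitian_metric A E T h \<longleftrightarrow>
     (\<forall>p. (\<forall>u\<in>E p. \<forall>v\<in>E p. \<forall>w\<in>E p. h p (u + v) w = h p u w + h p v w) \<and>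
          (\<forall>u\<in>E p. \<forall>w\<in>E p. \<forall>z. h p (z *\<^sub>C u) w = z * h p u w) \<and>
          (\<forall>u\<in>E p. \<forall>w\<in>E p. h p w u = cnj (h p u w)) \<and>
          (\<forall>u\<in>E p. u \<noteq> 0 \<longrightarrow> Re (h p u u) > 0)) \<and>
     (\<forall>t\<in>T. smooth_fun_on A (fst t) (\<lambda>p. h p (local_frame E t p) (local_frame E t p)))"

definition sections :: "('m::t2_space, 'n::finite) chart set \<Rightarrow>
    ('m \<Rightarrow> 'f::complex_vector set) \<Rightarrow> ('m, 'f) trivialization set \<Rightarrow> ('m \<Rightarrow> 'f) set" where
  "sections A E T = {s. (\<forall>p. s p \<in> E p) \<and> (\<forall>t\<in>T. smooth_fun_on A (fst t) (\<lambda>p. snd t p (s p)))}"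

definition twisted_forms :: "('m::t2_space, 'n::finite) chart set \<Rightarrow>
    ('m \<Rightarrow> 'f::complex_vector set) \<Rightarrow> ('m, 'f) trivialization set \<Rightarrow> ('m, 'n, 'f) form set" where
  "twisted_forms A E T = {\<psi>. (\<forall>p vs. \<psi> p vs \<in> E p) \<and> (\<forall>p. alternating_at A p (\<psi> p)) \<and>
     (\<forall>t\<in>T. smooth_form_on A (fst t) (\<lambda>p vs. snd t p (\<psi> p vs)))}"

definition scale_form ::
  "complex \<Rightarrow> ('m, 'n, 'f::complex_vector) form \<Rightarrow> ('m, 'n, 'f) form" where
  "scale_form z \<psi> = (\<lambda>p vs. z *\<^sub>C \<psi> p vs)"

text \<open>A connection sends a section to a twisted form of degree 1.\<close>

definition connection :: "('m::t2_space, 'n::finite) chart set \<Rightarrow>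
    ('m \<Rightarrow> 'f::complex_vector set) \<Rightarrow> ('m, 'f) trivialization set \<Rightarrow>
    (('m \<Rightarrow> 'f) \<Rightarrow> ('m, 'n, 'f) form) \<Rightarrow> bool" where
  "connection A E T nabla \<longleftrightarrow>
     (\<forall>s\<in>sections A E T. nabla s \<in> twisted_forms A E T \<inter> of_degree 1) \<and>
     (\<forall>s\<in>sections A E T. \<forall>t\<in>sections A E T. nabla (s + t) = nabla s + nabla t) \<and>
     (\<forall>s\<in>sections A E T. \<forall>f. smooth_fun_on A UNIV f \<longrightarrow>
        nabla (\<lambda>p. f p *\<^sub>C s p) =
          (\<lambda>p vs. ext_deriv A (zero_form f) p vs *\<^sub>C s p + f p *\<^sub>C nabla s p vs))"

definition unitary_connection :: "('m::t2_space, 'n::finite) chart set \<Rightarrow>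
    ('m \<Rightarrow> 'f::complex_vector set) \<Rightarrow> ('m, 'f) trivialization set \<Rightarrow>
    ('m \<Rightarrow> 'f \<Rightarrow> 'f \<Rightarrow> complex) \<Rightarrow> (('m \<Rightarrow> 'f) \<Rightarrow> ('m, 'n, 'f) form) \<Rightarrow> bool" where
  "unitary_connection A E T h nabla \<longleftrightarrow> connection A E T nabla \<and>
     (\<forall>s\<in>sections A E T. \<forall>t\<in>sections A E T. \<forall>p. \<forall>v\<in>tangent_space A p.
        ext_deriv A (zero_form (\<lambda>q. h q (s q) (t q))) p [v] =
          h p (nabla s p [v]) (t p) + h p (s p) (nabla t p [v]))"

text \<open>The operator induced by a connection on twisted forms: the complex linear operator of degree 1 with
  \(\nabla(\alpha \otimes s) = d\alpha \otimes s + (-1)^k \alpha \wedge \nabla s\)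
  for forms \<open>\<alpha>\<close> of degree \<open>k\<close> and sections \<open>s\<close>. On a compact manifold these products span all twisted
  forms, so the operator is unique on twisted forms; its values elsewhere are irrelevant. The
  case of the constant \<open>\<alpha> = 1\<close> says that it extends the connection.\<close>

definition induced_operator :: "('m::t2_space, 'n::finite) chart set \<Rightarrow>
    ('m \<Rightarrow> 'f::complex_vector set) \<Rightarrow> ('m, 'f) trivialization set \<Rightarrow>
    (('m \<Rightarrow> 'f) \<Rightarrow> ('m, 'n, 'f) form) \<Rightarrow> (('m, 'n, 'f) form \<Rightarrow> ('m, 'n, 'f) form) \<Rightarrow> bool" where
  "induced_operator A E T nabla D \<longleftrightarrow>
     (\<forall>k. \<forall>\<psi>\<in>twisted_forms A E T \<inter> of_degree k. D \<psi> \<in> twisted_forms A E T \<inter> of_degree (Suc k)) \<and>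
     (\<forall>\<psi>\<in>twisted_forms A E T. \<forall>\<phi>\<in>twisted_forms A E T. D (\<psi> + \<phi>) = D \<psi> + D \<phi>) \<and>
     (\<forall>\<psi>\<in>twisted_forms A E T. \<forall>z. D (scale_form z \<psi>) = scale_form z (D \<psi>)) \<and>
     (\<forall>k. \<forall>\<alpha>\<in>forms A \<inter> of_degree k. \<forall>s\<in>sections A E T.
        D (wedge \<alpha> (zero_form s)) =
          wedge (ext_deriv A \<alpha>) (zero_form s) + scale_form ((-1) ^ k) (wedge \<alpha> (nabla s)))"


section \<open>Prequantum systems and their operators\<close>

definition L_op ::
  "('m, 'n, real) form \<Rightarrow> ('m, 'n, 'f::complex_vector) form \<Rightarrow> ('m, 'n, 'f) form" where
  "L_op \<omega> \<psi> = wedge \<omega> \<psi>"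

text \<open>\<open>D\<close> stands for the operator induced by \<open>nabla\<close>.\<close>

definition prequantum_system :: "nat \<Rightarrow> ('m::t2_space, 'n::finite) chart set \<Rightarrow>
    ('m, 'n, real) form \<Rightarrow> ('m \<Rightarrow> 'f::complex_vector set) \<Rightarrow> ('m, 'f) trivialization set \<Rightarrow>
    ('m \<Rightarrow> 'f \<Rightarrow> 'f \<Rightarrow> complex) \<Rightarrow> (('m \<Rightarrow> 'f) \<Rightarrow> ('m, 'n, 'f) form) \<Rightarrow>
    (('m, 'n, 'f) form \<Rightarrow> ('m, 'n, 'f) form) \<Rightarrow> bool" where
  "prequantum_system m A \<omega> E T h nabla D \<longleftrightarrow>
     CARD('n) = 2 * m \<and> compact (UNIV :: 'm set) \<and> connected (UNIV :: 'm set) \<and>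
     smooth_atlas A \<and> symplectic_form A \<omega> \<and>
     complex_line_bundle A E T \<and> hermitian_metric A E T h \<and> unitary_connection A E T h nabla \<and>
     induced_operator A E T nabla D \<and>
     (\<forall>\<psi>\<in>twisted_forms A E T. D (D \<psi>) = scale_form (- \<i>) (L_op \<omega> \<psi>))"

definition omega_matrix :: "('m::t2_space, 'n::finite) chart set \<Rightarrow> ('m, 'n, real) form \<Rightarrow>
    ('m, 'n) chart \<Rightarrow> 'm \<Rightarrow> real ^ 'n ^ 'n" where
  "omega_matrix A \<omega> c p =
     (\<chi> i j. \<omega> p [coord_vector A c (axis i 1) p, coord_vector A c (axis j 1) p])"

text \<open>Computed at each point in some chart around it; the result does not depend on the chart.\<close>

definition Lambda_op :: "('m::t2_space, 'n::finite) chart set \<Rightarrow> ('m, 'n, real) form \<Rightarrow>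
    ('m, 'n, 'f::complex_vector) form \<Rightarrow> ('m, 'n, 'f) form" where
  "Lambda_op A \<omega> \<psi> = (\<lambda>p vs. let c = chart_at A p in
     (1/2) *\<^sub>R (\<Sum>i\<in>UNIV. \<Sum>j\<in>UNIV. matrix_inv (omega_matrix A \<omega> c p) $ i $ j *\<^sub>R
       interior_product (coord_vector A c (axis i 1))
         (interior_product (coord_vector A c (axis j 1)) \<psi>) p vs))"

definition H_op :: "nat \<Rightarrow> ('m, 'n, 'f::complex_vector) form \<Rightarrow> ('m, 'n, 'f) form" where
  "H_op m \<psi> = (\<lambda>p vs. (real m - real (length vs)) *\<^sub>R \<psi> p vs)"

definition nabla_Lambda :: "('m::t2_space, 'n::finite) chart set \<Rightarrow> ('m, 'n, real) form \<Rightarrow>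
    (('m, 'n, 'f::complex_vector) form \<Rightarrow> ('m, 'n, 'f) form) \<Rightarrow>
    ('m, 'n, 'f) form \<Rightarrow> ('m, 'n, 'f) form" where
  "nabla_Lambda A \<omega> D \<psi> = D (Lambda_op A \<omega> \<psi>) - Lambda_op A \<omega> (D \<psi>)"


section \<open>The Lie superalgebra osp(1|2) and its representations\<close>

text \<open>Parities are the numbers 0 and 1, and a superspace \<open>V\<close> is given by its homogeneous parts \<open>V 0\<close> and
  \<open>V 1\<close>. The defining superspace of osp(1|2) has an even coordinate, of index 1, and two odd ones, of
  indices 2 and 3. (In the index type \<open>3\<close> the numeral 3 denotes the third element, which equals 0.)\<close>

definition super_total :: "(nat \<Rightarrow> 'w::ab_group_add set) \<Rightarrow> 'w set" where
  "super_total V = {u + w | u w. u \<in> V 0 \<and> w \<in> V 1}"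

definition index_parity :: "3 \<Rightarrow> nat" where
  "index_parity i = (if i = 1 then 0 else 1)"

definition matrix_unit :: "3 \<Rightarrow> 3 \<Rightarrow> complex ^ 3 ^ 3" where
  "matrix_unit a b = (\<chi> i j. if i = a \<and> j = b then 1 else 0)"

text \<open>The Gram matrix of the even, supersymmetric, nondegenerate bilinear form: symmetric on the even
  line, skew-symmetric on the odd plane.\<close>

definition osp_gram :: "complex ^ 3 ^ 3" where
  "osp_gram = matrix_unit 1 1 + matrix_unit 2 3 - matrix_unit 3 2"

text \<open>Matrices \<open>X\<close> of parity \<open>q\<close> with \(B(Xu,v) + (-1)^{q|u|} B(u,Xv) = 0\), written out for
  the basis vectors \(u = e_i\), \(v = e_j\).\<close>

definition osp12 :: "nat \<Rightarrow> (complex ^ 3 ^ 3) set" where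
  "osp12 q = {X.
     (\<forall>i j. (index_parity i + index_parity j) mod 2 \<noteq> q \<longrightarrow> X $ i $ j = 0) \<and>
     (\<forall>i j. (\<Sum>k\<in>UNIV. X $ k $ i * osp_gram $ k $ j)
        + (-1) ^ (q * index_parity i) * (\<Sum>k\<in>UNIV. osp_gram $ i $ k * X $ k $ j) = 0)}"

definition superbracket :: "nat \<Rightarrow> nat \<Rightarrow> complex ^ 3 ^ 3 \<Rightarrow> complex ^ 3 ^ 3 \<Rightarrow> complex ^ 3 ^ 3" where
  "superbracket q r X Y = X ** Y - (\<chi> i j. (-1) ^ (q * r) * (Y ** X) $ i $ j)"

text \<open>Even complex linear representations of osp(1|2) on a superspace \<open>V\<close> with scalar multiplication
  \<open>sc\<close>.\<close>

definition osp12_representation :: "(complex \<Rightarrow> 'w \<Rightarrow> 'w) \<Rightarrow> (nat \<Rightarrow> 'w::ab_group_add set) \<Rightarrow>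
    (complex ^ 3 ^ 3 \<Rightarrow> 'w \<Rightarrow> 'w) \<Rightarrow> bool" where
  "osp12_representation sc V \<rho> \<longleftrightarrow>
     (\<forall>X\<in>super_total osp12. \<forall>u\<in>super_total V. \<forall>w\<in>super_total V. \<rho> X (u + w) = \<rho> X u + \<rho> X w) \<and>
     (\<forall>X\<in>super_total osp12. \<forall>u\<in>super_total V. \<forall>z. \<rho> X (sc z u) = sc z (\<rho> X u)) \<and>
     (\<forall>X\<in>super_total osp12. \<forall>Y\<in>super_total osp12. \<forall>u\<in>super_total V.
        \<rho> (X + Y) u = \<rho> X u + \<rho> Y u) \<and>
     (\<forall>X\<in>super_total osp12. \<forall>u\<in>super_total V. \<forall>z.
        \<rho> (\<chi> i j. z * X $ i $ j) u = sc z (\<rho> X u)) \<and>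
     (\<forall>q\<in>{0, 1}. \<forall>r\<in>{0, 1}. \<forall>X\<in>osp12 q. \<forall>u\<in>V r. \<rho> X u \<in> V ((q + r) mod 2)) \<and>
     (\<forall>q\<in>{0, 1}. \<forall>r\<in>{0, 1}. \<forall>X\<in>osp12 q. \<forall>Y\<in>osp12 r. \<forall>u\<in>super_total V.
        \<rho> (superbracket q r X Y) u = \<rho> X (\<rho> Y u) - sc ((-1) ^ (q * r)) (\<rho> Y (\<rho> X u)))"

text \<open>The standard generators: \<open>osp_e\<close>, \<open>osp_f\<close>, \<open>osp_h\<close> form the standard sl(2) triple of the even part,
  and the odd elements have weights 1 and -1 under \<open>osp_h\<close>.\<close>

definition osp_e :: "complex ^ 3 ^ 3" where "osp_e = matrix_unit 2 3"
definition osp_f :: "complex ^ 3 ^ 3" where "osp_f = matrix_unit 3 2"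
definition osp_h :: "complex ^ 3 ^ 3" where "osp_h = matrix_unit 2 2 - matrix_unit 3 3"
definition osp_q_plus :: "complex ^ 3 ^ 3" where "osp_q_plus = matrix_unit 2 1 - matrix_unit 1 3"
definition osp_q_minus :: "complex ^ 3 ^ 3" where "osp_q_minus = matrix_unit 3 1 + matrix_unit 1 2"

lemma osp12_even_span:
  "osp12 0 = {X. \<exists>a b c. X = (\<chi> i j. a * osp_e $ i $ j + b * osp_f $ i $ j + c * osp_h $ i $ j)}"
  unfolding osp12_def osp_gram_def matrix_unit_def index_parity_def osp_e_def osp_f_def osp_h_def
  by (auto simp: vec_eq_iff forall_3 sum_3)

lemma osp12_odd_span:
  "osp12 1 = {X. \<exists>a b. X = (\<chi> i j. a * osp_q_plus $ i $ j + b * osp_q_minus $ i $ j)}"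
  unfolding osp12_def osp_gram_def matrix_unit_def index_parity_def osp_q_plus_def osp_q_minus_def
  by (auto simp: vec_eq_iff forall_3 sum_3 add_eq_0_iff)

lemma osp12_brackets:
  "superbracket 0 0 osp_h osp_e = 2 *\<^sub>R osp_e"
  "superbracket 0 0 osp_h osp_f = - 2 *\<^sub>R osp_f"
  "superbracket 0 0 osp_e osp_f = osp_h"
  "superbracket 0 1 osp_h osp_q_plus = osp_q_plus"
  "superbracket 0 1 osp_h osp_q_minus = - osp_q_minus"
  "superbracket 0 1 osp_e osp_q_plus = 0"
  "superbracket 0 1 osp_e osp_q_minus = osp_q_plus"
  "superbracket 0 1 osp_f osp_q_plus = osp_q_minus"
  "superbracket 0 1 osp_f osp_q_minus = 0"
  "superbracket 1 1 osp_q_plus osp_q_minus = osp_h"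
  "superbracket 1 1 osp_q_plus osp_q_plus = - 2 *\<^sub>R osp_e"
  "superbracket 1 1 osp_q_minus osp_q_minus = 2 *\<^sub>R osp_f"
  unfolding superbracket_def matrix_matrix_mult_def matrix_unit_def
    osp_e_def osp_f_def osp_h_def osp_q_plus_def osp_q_minus_def
  by (auto simp: vec_eq_iff forall_3 sum_3 scaleR_conv_of_real)

definition twisted_forms_super :: "('m::t2_space, 'n::finite) chart set \<Rightarrow>
    ('m \<Rightarrow> 'f::complex_vector set) \<Rightarrow> ('m, 'f) trivialization set \<Rightarrow>
    nat \<Rightarrow> ('m, 'n, 'f) form set" where
  "twisted_forms_super A E T q =
     {\<psi> \<in> twisted_forms A E T. \<forall>p vs. length vs mod 2 \<noteq> q \<longrightarrow> \<psi> p vs = 0}"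

end

theory Submission
  imports Defs
begin

text \<open>Choose \<open>b\<close> with \<open>b\<^sup>2 = \<i>\<close> and put \<open>Q = b\<nabla>\<close>, so that \<open>Q\<^sup>2 = L\<close>. In particular \<open>Q\<close> commutes with
  \<open>L\<close>, and \<open>L\<close> preserves smooth twisted forms; neither needs \<open>d\<omega> = 0\<close>. Given \<open>[\<Lambda>, L] = H\<close>, which is
  linear algebra at each point, and the degrees of the operators, all relations follow formally
  from \<open>P = [\<Lambda>, Q]\<close> except \<open>[\<Lambda>, P] = 0\<close>. That one holds since \<open>[\<Lambda>, P]\<close> commutes with \<open>L\<close> and
  has \<open>H\<close>-weight 3, while only finitely many weights occur: a lowest weight vector of a
  finite-dimensional \<open>sl(2)\<close>-module cannot have positive weight.\<close>

section \<open>Calculus of smooth maps\<close>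

text \<open>Classically, \<open>[\<Lambda>, P] = 0\<close> is obtained from a local computation in
  Darboux coordinates. The algebraic substitute rests on an observation about brackets:
  \<open>[L, Q] = 0\<close> and \<open>[L, P] = Q\<close>, so that \<open>Q\<close> and
  \<open>P\<close> behave like the two weight vectors of the standard representation of sl(2), and
  \<open>[\<Lambda>, P]\<close> is the first vector beyond its top. The operators on twisted forms
  make up an infinite-dimensional space, so the theory of finite-dimensional modules is not applied
  to it as such. Instead, each further bracket with \<Lambda> raises the weight by 2, until the
  shift exceeds the distance 2m between the extreme weights m and -m and the operator must vanish;
  brackets with \<open>L\<close> then lead back down with nonzero factors. \<Lambda> is the raising
  operator because \<open>H\<close> is m - k in degree k. The analysis serves one purpose: \<Lambda>
  has to preserve smooth twisted forms. It is given by the inverse of the matrix of \<omega>, in a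
  chart that is chosen anew at every point.\<close>

lemma frechet_derivative_cong_open:
  assumes "open S" "x \<in> S" "\<And>y. y \<in> S \<Longrightarrow> f y = g y"
  shows "frechet_derivative f (at x) = frechet_derivative g (at x)"
proof -
  have "(f has_derivative F) (at x) \<longleftrightarrow> (g has_derivative F) (at x)" for F
    using assms by (metis has_derivative_transform_within_open)
  then show ?thesis by (simp add: frechet_derivative_def)
qed

lemma differentiable_cong_open:
  assumes "open S" "x \<in> S" "\<And>y. y \<in> S \<Longrightarrow> f y = g y"
  shows "f differentiable (at x) \<longleftrightarrow> g differentiable (at x)"
  unfolding differentiable_def
  using assms by (metis has_derivative_transform_within_open)

lemma C_diff_on_cong:
  assumes "open S" "\<And>y. y \<in> S \<Longrightarrow> f y = g y"
  shows "C_diff_on n S f \<longleftrightarrow> C_diff_on n S g"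
  using assms(2)
proof (induction n arbitrary: f g)
  case 0
  then show ?case by (simp cong: continuous_on_cong)
next
  case (Suc n)
  have "frechet_derivative f (at x) v = frechet_derivative g (at x) v" if "x \<in> S" for x v
    using frechet_derivative_cong_open[OF assms(1) that Suc.prems] by simp
  from Suc.IH[OF this] show ?case
    using differentiable_cong_open[OF assms(1) _ Suc.prems] by auto
qed

lemma smooth_on_cong:
  assumes "open S" "\<And>y. y \<in> S \<Longrightarrow> f y = g y"
  shows "smooth_on S f \<longleftrightarrow> smooth_on S g"
  using C_diff_on_cong[OF assms] by (simp add: smooth_on_def)

lemma C_diff_on_subset: "C_diff_on n S f \<Longrightarrow> S' \<subseteq> S \<Longrightarrow> C_diff_on n S' f"
  by (induction n arbitrary: f) (auto intro: continuous_on_subset)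

lemma smooth_on_subset: "smooth_on S f \<Longrightarrow> S' \<subseteq> S \<Longrightarrow> smooth_on S' f"
  by (auto simp: smooth_on_def intro: C_diff_on_subset)

text \<open>The derivative of a product or an inverse contains undifferentiated factors as well. In
  an induction on the order these must be lowered by one order before the induction hypothesis
  applies.\<close>

lemma C_diff_on_SucD: "C_diff_on (Suc n) S f \<Longrightarrow> C_diff_on n S f"
proof (induction n arbitrary: f)
  case 0
  then show ?case
    by (auto intro!: continuous_at_imp_continuous_on differentiable_imp_continuous_within)
next
  case (Suc n)
  from Suc.prems have "C_diff_on (Suc n) S (\<lambda>x. frechet_derivative f (at x) v)" for v
    unfolding C_diff_on.simps(2)[of "Suc n"] by blast
  then have "C_diff_on n S (\<lambda>x. frechet_derivative f (at x) v)" for v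
    by (rule Suc.IH)
  with Suc.prems show ?case by simp
qed

lemma C_diff_on_const: "C_diff_on n S (\<lambda>x. k)"
proof (induction n arbitrary: k)
  case (Suc n)
  show ?case using Suc[of 0] by simp
qed simp

lemma C_diff_on_add:
  assumes "open S" "C_diff_on n S f" "C_diff_on n S g"
  shows "C_diff_on n S (\<lambda>x. f x + g x)"
  using assms(2,3)
proof (induction n arbitrary: f g)
  case 0
  then show ?case by (simp add: continuous_on_add)
next
  case (Suc n)
  let ?D = "\<lambda>x v. frechet_derivative f (at x) v + frechet_derivative g (at x) v"
  have D: "((\<lambda>x. f x + g x) has_derivative ?D x) (at x)" if "x \<in> S" for x
    using Suc.prems that by (intro has_derivative_add) (auto simp: frechet_derivative_works[symmetric])
  have "C_diff_on n S (\<lambda>x. ?D x v)" for v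
    using Suc by simp
  then have "C_diff_on n S (\<lambda>x. frechet_derivative (\<lambda>x. f x + g x) (at x) v)" for v
    by (subst C_diff_on_cong[OF assms(1), where g = "\<lambda>x. ?D x v"])
      (simp_all add: frechet_derivative_at[OF D, symmetric])
  with Suc.prems show ?case by (simp add: differentiable_add)
qed

lemma (in bounded_bilinear) C_diff_on_bilinear:
  assumes "open S" "C_diff_on n S f" "C_diff_on n S g"
  shows "C_diff_on n S (\<lambda>x. prod (f x) (g x))"
  using assms(2,3)
proof (induction n arbitrary: f g)
  case 0
  then show ?case by (simp add: continuous_on)
next
  case (Suc n)
  let ?D = "\<lambda>x v. prod (f x) (frechet_derivative g (at x) v) +
                  prod (frechet_derivative f (at x) v) (g x)"
  have D: "((\<lambda>x. prod (f x) (g x)) has_derivative ?D x) (at x)" if "x \<in> S" for x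
    using Suc.prems that by (intro FDERIV) (auto simp: frechet_derivative_works[symmetric])
  have "C_diff_on n S (\<lambda>x. ?D x v)" for v
    using Suc.prems C_diff_on_SucD[of n S f] C_diff_on_SucD[of n S g]
    by (intro C_diff_on_add[OF assms(1)] Suc.IH) auto
  then have "C_diff_on n S (\<lambda>x. frechet_derivative (\<lambda>x. prod (f x) (g x)) (at x) v)" for v
    by (subst C_diff_on_cong[OF assms(1), where g = "\<lambda>x. ?D x v"])
      (simp_all add: frechet_derivative_at[OF D, symmetric])
  moreover have "(\<lambda>x. prod (f x) (g x)) differentiable at x" if "x \<in> S" for x
    using D[OF that] by (rule differentiableI)
  ultimately show ?case by simp
qed

lemma C_diff_on_inverse:
  fixes f :: "'a::real_normed_vector \<Rightarrow> 'b::real_normed_div_algebra"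
  assumes "open S" "C_diff_on n S f" "\<And>x. x \<in> S \<Longrightarrow> f x \<noteq> 0"
  shows "C_diff_on n S (\<lambda>x. inverse (f x))"
  using assms(2)
proof (induction n)
  case 0
  then show ?case using assms(3) by (simp add: continuous_on_inverse)
next
  case (Suc n)
  \<comment> \<open>With the sign written as a constant factor, the derivative is built from
    products only, and the bilinear rule covers it.\<close>
  let ?D = "\<lambda>x v. - 1 * (inverse (f x) * frechet_derivative f (at x) v * inverse (f x))"
  have D: "((\<lambda>x. inverse (f x)) has_derivative ?D x) (at x)" if "x \<in> S" for x
  proof -
    have "(f has_derivative frechet_derivative f (at x)) (at x)"
      using Suc.prems that by (simp add: frechet_derivative_works[symmetric])
    from Deriv.has_derivative_inverse[OF assms(3)[OF that] this] show ?thesis by simp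
  qed
  have "C_diff_on n S (\<lambda>x. ?D x v)" for v
    using Suc.prems Suc.IH[OF C_diff_on_SucD]
    by (intro bounded_bilinear.C_diff_on_bilinear[OF bounded_bilinear_mult assms(1)] C_diff_on_const) auto
  then have "C_diff_on n S (\<lambda>x. frechet_derivative (\<lambda>x. inverse (f x)) (at x) v)" for v
    by (subst C_diff_on_cong[OF assms(1), where g = "\<lambda>x. ?D x v"])
      (simp_all only: frechet_derivative_at[OF D, symmetric])
  moreover have "(\<lambda>x. inverse (f x)) differentiable at x" if "x \<in> S" for x
    using D[OF that] by (rule differentiableI)
  ultimately show ?case by simp
qed

lemma smooth_on_const: "smooth_on S (\<lambda>x. k)"
  by (simp add: smooth_on_def C_diff_on_const)

lemma smooth_on_add:
  "open S \<Longrightarrow> smooth_on S f \<Longrightarrow> smooth_on S g \<Longrightarrow> smooth_on S (\<lambda>x. f x + g x)"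
  by (simp add: smooth_on_def C_diff_on_add)

lemma smooth_on_scaleR:
  "open S \<Longrightarrow> smooth_on S f \<Longrightarrow> smooth_on S g \<Longrightarrow> smooth_on S (\<lambda>x. f x *\<^sub>R g x)"
  by (simp add: smooth_on_def bounded_bilinear.C_diff_on_bilinear[OF bounded_bilinear_scaleR])

lemma smooth_on_mult:
  fixes f g :: "'a::real_normed_vector \<Rightarrow> 'b::real_normed_algebra"
  shows "open S \<Longrightarrow> smooth_on S f \<Longrightarrow> smooth_on S g \<Longrightarrow> smooth_on S (\<lambda>x. f x * g x)"
  by (simp add: smooth_on_def bounded_bilinear.C_diff_on_bilinear[OF bounded_bilinear_mult])

lemma smooth_on_inverse:
  fixes f :: "'a::real_normed_vector \<Rightarrow> 'b::real_normed_div_algebra"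
  shows "open S \<Longrightarrow> smooth_on S f \<Longrightarrow> (\<And>x. x \<in> S \<Longrightarrow> f x \<noteq> 0) \<Longrightarrow> smooth_on S (\<lambda>x. inverse (f x))"
  by (simp add: smooth_on_def C_diff_on_inverse)

lemma smooth_on_sum:
  "open S \<Longrightarrow> (\<And>i. i \<in> I \<Longrightarrow> smooth_on S (f i)) \<Longrightarrow> smooth_on S (\<lambda>x. \<Sum>i\<in>I. f i x)"
  by (induction I rule: infinite_finite_induct) (simp_all add: smooth_on_const smooth_on_add)

lemma smooth_on_prod:
  fixes f :: "'i \<Rightarrow> 'a::real_normed_vector \<Rightarrow> 'b::real_normed_field"
  shows "open S \<Longrightarrow> (\<And>i. i \<in> I \<Longrightarrow> smooth_on S (f i)) \<Longrightarrow> smooth_on S (\<lambda>x. \<Prod>i\<in>I. f i x)"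
  by (induction I rule: infinite_finite_induct) (simp_all add: smooth_on_const smooth_on_mult)

section \<open>Smooth dependence of determinants and inverse matrices on a parameter\<close>

lemma smooth_on_det:
  fixes M :: "'a::real_normed_vector \<Rightarrow> real ^ 'n ^ 'n"
  assumes "open S" "\<And>i j. smooth_on S (\<lambda>x. M x $ i $ j)"
  shows "smooth_on S (\<lambda>x. det (M x))"
  unfolding det_def
  by (intro smooth_on_sum smooth_on_mult smooth_on_prod smooth_on_const assms)

lemma matrix_inv_right: "invertible M \<Longrightarrow> M ** matrix_inv M = mat 1"
  unfolding invertible_def matrix_inv_def by (rule someI2_ex) auto

text \<open>Cramer's rule for the right-hand side \<open>axis l 1\<close>, whose solution is column
  \<open>l\<close> of the inverse. It exhibits the entries as rational functions of the entries of
  \<open>M\<close>, from which smoothness can be read off.\<close>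

lemma matrix_inv_component:
  fixes M :: "real ^ 'n ^ 'n"
  assumes "invertible M"
  shows "matrix_inv M $ k $ l =
    det (\<chi> i j. if j = k then axis l 1 $ i else M $ i $ j) * inverse (det M)"
proof -
  have "M *v (matrix_inv M *v axis l 1) = axis l 1"
    by (simp add: matrix_vector_mul_assoc matrix_inv_right[OF assms])
  then have "matrix_inv M *v axis l 1 =
      (\<chi> k. det (\<chi> i j. if j = k then axis l 1 $ i else M $ i $ j) / det M)"
    using cramer assms invertible_det_nz by blast
  moreover have "(matrix_inv M *v axis l 1) $ k = matrix_inv M $ k $ l"
    by (simp add: matrix_vector_mul_component inner_axis)
  ultimately show ?thesis by (simp add: divide_inverse)
qed

lemma smooth_on_matrix_inv:
  fixes M :: "'a::real_normed_vector \<Rightarrow> real ^ 'n ^ 'n"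
  assumes "open S" "\<And>i j. smooth_on S (\<lambda>x. M x $ i $ j)" "\<And>x. x \<in> S \<Longrightarrow> invertible (M x)"
  shows "smooth_on S (\<lambda>x. matrix_inv (M x) $ k $ l)"
proof -
  let ?g = "\<lambda>x. det (\<chi> i j. if j = k then axis l 1 $ i else M x $ i $ j) * inverse (det (M x))"
  have "smooth_on S (\<lambda>x. (\<chi> i j. if j = k then axis l 1 $ i else M x $ i $ j) $ i $ j)" for i j
    using assms(2) by (cases "j = k") (simp_all add: smooth_on_const)
  then have "smooth_on S ?g"
    using assms by (intro smooth_on_mult smooth_on_inverse smooth_on_det) (auto simp: invertible_det_nz)
  then show ?thesis
    by (subst smooth_on_cong[OF assms(1) matrix_inv_component[OF assms(3)]])
qed

section \<open>Tangent vectors and coordinates\<close>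

locale atlas =
  fixes A :: "('m::t2_space, 'n::finite) chart set"
  assumes atlas: "smooth_atlas A"
begin

lemma chart_at: "chart_at A p \<in> A \<and> p \<in> fst (chart_at A p)"
proof -
  have "p \<in> (\<Union>c\<in>A. fst c)" using atlas by (simp add: smooth_atlas_def)
  then have "\<exists>c. c \<in> A \<and> p \<in> fst c" by blast
  then show ?thesis unfolding chart_at_def by (rule someI_ex)
qed

lemma chart_inj: "c \<in> A \<Longrightarrow> inj_on (snd c) (fst c)"
  using atlas unfolding smooth_atlas_def is_chart_def homeomorphism_def
  by (metis inj_on_inverseI)

lemma chart_inv_eq [simp]: "c \<in> A \<Longrightarrow> p \<in> fst c \<Longrightarrow> chart_inv c (snd c p) = p"
  by (simp add: chart_inj)

lemma open_chart_image:
  assumes "c \<in> A" "open V"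
  shows "open (snd c ` (fst c \<inter> V))"
proof -
  have c: "open (fst c)" "open (snd c ` fst c)"
    "homeomorphism (fst c) (snd c ` fst c) (snd c) (chart_inv c)"
    using atlas assms(1) by (auto simp: smooth_atlas_def is_chart_def)
  have "openin (top_of_set (snd c ` fst c)) (snd c ` (fst c \<inter> V))"
    using c(3) by (rule homeomorphism_imp_open_map) (simp add: assms(2) openin_open_Int)
  then show ?thesis using c(2) by (meson openin_open_eq)
qed

lemma open_chart: "c \<in> A \<Longrightarrow> open (fst c)"
  using atlas by (simp add: smooth_atlas_def is_chart_def)

abbreviation transition :: "('m, 'n) chart \<Rightarrow> ('m, 'n) chart \<Rightarrow> 'm \<Rightarrow> real ^ 'n \<Rightarrow> real ^ 'n" where
  "transition c c' p \<equiv> frechet_derivative (snd c' \<circ> chart_inv c) (at (snd c p))"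

lemma has_derivative_transition:
  assumes "c \<in> A" "c' \<in> A" "p \<in> fst c" "p \<in> fst c'"
  shows "(snd c' \<circ> chart_inv c has_derivative transition c c' p) (at (snd c p))"
proof -
  have "C_diff_on (Suc 0) (snd c ` (fst c \<inter> fst c')) (snd c' \<circ> chart_inv c)"
    using atlas assms(1,2) unfolding smooth_atlas_def smooth_on_def by blast
  then have "(snd c' \<circ> chart_inv c) differentiable (at (snd c p))"
    using assms by auto
  then show ?thesis by (simp add: frechet_derivative_works)
qed

lemma transition_self:
  assumes "c \<in> A" "p \<in> fst c"
  shows "transition c c p e = e"
proof -
  have "transition c c p = frechet_derivative (\<lambda>x. x) (at (snd c p))"
    using open_chart_image[OF assms(1) open_UNIV] assms
    by (intro frechet_derivative_cong_open[where S = "snd c ` fst c"]) auto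
  then show ?thesis by simp
qed

text \<open>The chain rule. The composite of two coordinate changes agrees with the direct one only
  where all three charts are defined, which is an open neighbourhood of the point.\<close>

lemma transition_transition:
  assumes "c \<in> A" "c1 \<in> A" "c2 \<in> A" "p \<in> fst c" "p \<in> fst c1" "p \<in> fst c2"
  shows "transition c1 c2 p (transition c c1 p e) = transition c c2 p e"
proof -
  let ?S = "snd c ` (fst c \<inter> (fst c1 \<inter> fst c2))"
  have "(snd c2 \<circ> chart_inv c1 has_derivative transition c1 c2 p)
      (at ((snd c1 \<circ> chart_inv c) (snd c p)))"
    using has_derivative_transition[of c1 c2 p] assms by simp
  from diff_chain_at[OF has_derivative_transition[OF assms(1,2,4,5)] this]
  have "((snd c2 \<circ> chart_inv c1) \<circ> (snd c1 \<circ> chart_inv c) has_derivative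
      transition c1 c2 p \<circ> transition c c1 p) (at (snd c p))" .
  then have "(snd c2 \<circ> chart_inv c has_derivative
      transition c1 c2 p \<circ> transition c c1 p) (at (snd c p))"
    using assms open_chart[of c1] open_chart[of c2]
    by (elim has_derivative_transform_within_open[where s = ?S])
      (auto intro!: open_chart_image)
  from frechet_derivative_at[OF this] show ?thesis by (metis comp_apply)
qed

lemma coord_vector_tangent:
  assumes "c \<in> A" "p \<in> fst c"
  shows "coord_vector A c e p \<in> tangent_space A p"
  using assms by (auto simp: tangent_space_def coord_vector_def transition_transition)

lemma coord_vector_component:
  assumes "c \<in> A" "p \<in> fst c"
  shows "coord_vector A c e p c = e"
  using assms by (simp add: coord_vector_def transition_self)

text \<open>This reduces every pointwise computation with tangent vectors to components in a single
  chart around the point.\<close>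

lemma tangent_eq_coord_vector:
  assumes "c \<in> A" "p \<in> fst c" "v \<in> tangent_space A p"
  shows "v = coord_vector A c (v c) p"
proof
  fix c'
  show "v c' = coord_vector A c (v c) p c'"
  proof (cases "c' \<in> A \<and> p \<in> fst c'")
    case True
    then have "v c' = transition c c' p (v c)"
      using assms unfolding tangent_space_def by blast
    with True show ?thesis by (simp only: coord_vector_def simp_thms if_True)
  next
    case False
    then have "v c' = 0"
      using assms(3) unfolding tangent_space_def by blast
    with False show ?thesis by (auto simp: coord_vector_def)
  qed
qed

lemma linear_transition:
  assumes "c \<in> A" "c' \<in> A" "p \<in> fst c" "p \<in> fst c'"
  shows "linear (transition c c' p)"
  using has_derivative_transition[OF assms] has_derivative_linear by blast

lemma coord_vector_add:
  assumes "c \<in> A" "p \<in> fst c"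
  shows "coord_vector A c (x + y) p = (\<lambda>c'. coord_vector A c x p c' + coord_vector A c y p c')"
proof
  fix c'
  show "coord_vector A c (x + y) p c' = coord_vector A c x p c' + coord_vector A c y p c'"
    using assms linear_add[OF linear_transition, of c c' p]
    by (cases "c' \<in> A \<and> p \<in> fst c'") (auto simp: coord_vector_def)
qed

lemma coord_vector_scaleR:
  assumes "c \<in> A" "p \<in> fst c"
  shows "coord_vector A c (a *\<^sub>R x) p = (\<lambda>c'. a *\<^sub>R coord_vector A c x p c')"
proof
  fix c'
  show "coord_vector A c (a *\<^sub>R x) p c' = a *\<^sub>R coord_vector A c x p c'"
    using assms linear_scale[OF linear_transition, of c c' p]
    by (cases "c' \<in> A \<and> p \<in> fst c'") (auto simp: coord_vector_def)
qed

end


section \<open>Alternating functions at a point\<close>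

lemma alternating_at_outside:
  "alternating_at A p f \<Longrightarrow> \<not> set vs \<subseteq> tangent_space A p \<Longrightarrow> f vs = 0"
  by (simp add: alternating_at_def)

lemma alternating_at_addD:
  assumes "alternating_at A p f" "set vs \<subseteq> tangent_space A p" "i < length vs"
    "u \<in> tangent_space A p" "w \<in> tangent_space A p"
  shows "f (vs[i := \<lambda>c. u c + w c]) = f (vs[i := u]) + f (vs[i := w])"
  using assms(1)[unfolded alternating_at_def, THEN conjunct2, THEN conjunct1, rule_format, of vs i u w]
    assms(2-) by simp

lemma alternating_at_scaleD:
  assumes "alternating_at A p f" "set vs \<subseteq> tangent_space A p" "i < length vs"
    "u \<in> tangent_space A p"
  shows "f (vs[i := \<lambda>c. a *\<^sub>R u c]) = a *\<^sub>R f (vs[i := u])"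
  using assms(1)[unfolded alternating_at_def, THEN conjunct2, THEN conjunct2, THEN conjunct1,
      rule_format, of vs i u a] assms(2-) by simp

lemma alternating_at_repeat:
  assumes "alternating_at A p f" "i < length vs" "j < length vs" "i \<noteq> j" "vs ! i = vs ! j"
  shows "f vs = 0"
proof (cases "set vs \<subseteq> tangent_space A p")
  case True
  note R = assms(1)[unfolded alternating_at_def, THEN conjunct2, THEN conjunct2, THEN conjunct2,
    rule_format]
  from assms(4) consider "i < j" | "j < i" by linarith
  then show ?thesis
    by cases (use assms True R[of vs i j] R[of vs j i] in simp_all)
qed (use assms(1) in \<open>simp add: alternating_at_outside\<close>)

lemma alternating_atI:
  assumes "\<And>vs. \<not> set vs \<subseteq> tangent_space A p \<Longrightarrow> f vs = 0"
    and "\<And>vs i u w. set vs \<subseteq> tangent_space A p \<Longrightarrow> i < length vs \<Longrightarrow> u \<in> tangent_space A p \<Longrightarrow>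
      w \<in> tangent_space A p \<Longrightarrow> f (vs[i := \<lambda>c. u c + w c]) = f (vs[i := u]) + f (vs[i := w])"
    and "\<And>vs i u a. set vs \<subseteq> tangent_space A p \<Longrightarrow> i < length vs \<Longrightarrow> u \<in> tangent_space A p \<Longrightarrow>
      f (vs[i := \<lambda>c. a *\<^sub>R u c]) = a *\<^sub>R f (vs[i := u])"
    and "\<And>vs i j. set vs \<subseteq> tangent_space A p \<Longrightarrow> i < j \<Longrightarrow> j < length vs \<Longrightarrow> vs ! i = vs ! j \<Longrightarrow> f vs = 0"
  shows "alternating_at A p f"
  unfolding alternating_at_def
proof (intro conjI allI impI, goal_cases)
  case 1 then show ?case by (rule assms(1))
next
  case 2 then show ?case by (elim conjE) (rule assms(2))
next
  case 3 then show ?case by (elim conjE) (rule assms(3))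
next
  case 4 then show ?case by (elim conjE) (rule assms(4))
qed

lemma alternating_at_Cons:
  assumes f: "alternating_at A p f" and v: "v \<in> tangent_space A p"
  shows "alternating_at A p (\<lambda>vs. f (v # vs))"
proof (rule alternating_atI, goal_cases)
  case (1 vs)
  then show ?case using f by (simp add: alternating_at_outside)
next
  case (2 vs i u w)
  with v show ?case using alternating_at_addD[OF f, of "v # vs" "Suc i" u w] by simp
next
  case (3 vs i u a)
  with v show ?case using alternating_at_scaleD[OF f, of "v # vs" "Suc i" u a] by simp
next
  case (4 vs i j)
  then show ?case using alternating_at_repeat[OF f, of "Suc i" "v # vs" "Suc j"] by simp
qed

lemma alternating_at_zero: "alternating_at A p (\<lambda>vs. 0)"
  by (simp add: alternating_at_def)

lemma alternating_at_add:
  assumes "alternating_at A p f" "alternating_at A p g"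
  shows "alternating_at A p (\<lambda>vs. f vs + g vs)"
proof (rule alternating_atI, goal_cases)
  case (4 vs i j)
  then show ?case
    using alternating_at_repeat[OF assms(1), of i vs j] alternating_at_repeat[OF assms(2), of i vs j]
    by simp
qed (simp_all add: alternating_at_outside[OF assms(1)] alternating_at_outside[OF assms(2)]
    alternating_at_addD[OF assms(1)] alternating_at_addD[OF assms(2)]
    alternating_at_scaleD[OF assms(1)] alternating_at_scaleD[OF assms(2)] scaleR_add_right)

lemma alternating_at_sum:
  "(\<And>i. i \<in> I \<Longrightarrow> alternating_at A p (f i)) \<Longrightarrow> alternating_at A p (\<lambda>vs. \<Sum>i\<in>I. f i vs)"
  by (induction I rule: infinite_finite_induct) (simp_all add: alternating_at_zero alternating_at_add)

text \<open>A factor that depends on the degree covers constant multiples, the operator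
  \<open>H_op\<close> and the projections to degrees at once.\<close>

lemma alternating_at_length_scaleR:
  assumes "alternating_at A p f"
  shows "alternating_at A p (\<lambda>vs. r (length vs) *\<^sub>R f vs)"
proof (rule alternating_atI, goal_cases)
  case (4 vs i j)
  then show ?case using alternating_at_repeat[OF assms, of i vs j] by simp
qed (simp_all add: alternating_at_outside[OF assms] alternating_at_addD[OF assms]
    alternating_at_scaleD[OF assms] scaleR_add_right)

section \<open>Alternating functions in the coordinates of one chart\<close>

context atlas
begin

context
  fixes f :: "('m, 'n) tangent list \<Rightarrow> 'v::real_vector" and c p vs i
  assumes f: "alternating_at A p f" and c: "c \<in> A" "p \<in> fst c"
    and vs: "set vs \<subseteq> tangent_space A p" "i < length vs"
begin

lemma alternating_linear: "linear (\<lambda>x. f (vs[i := coord_vector A c x p]))"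
proof (rule linearI)
  fix x y and a :: real
  show "f (vs[i := coord_vector A c (x + y) p]) =
      f (vs[i := coord_vector A c x p]) + f (vs[i := coord_vector A c y p])"
    unfolding coord_vector_add[OF c] by (intro alternating_at_addD[OF f vs] coord_vector_tangent[OF c])
  show "f (vs[i := coord_vector A c (a *\<^sub>R x) p]) = a *\<^sub>R f (vs[i := coord_vector A c x p])"
    unfolding coord_vector_scaleR[OF c] by (intro alternating_at_scaleD[OF f vs] coord_vector_tangent[OF c])
qed

lemma alternating_expand:
  "f (vs[i := coord_vector A c x p]) =
    (\<Sum>k\<in>UNIV. (x $ k) *\<^sub>R f (vs[i := coord_vector A c (axis k 1) p]))"
proof -
  have "x = (\<Sum>k\<in>UNIV. (x $ k) *\<^sub>R axis k 1)"
    using basis_expansion[of x] by (simp add: scalar_mult_eq_scaleR)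
  then have "f (vs[i := coord_vector A c x p]) =
      f (vs[i := coord_vector A c (\<Sum>k\<in>UNIV. (x $ k) *\<^sub>R axis k 1) p])" by simp
  then show ?thesis
    by (simp add: linear_sum[OF alternating_linear] linear_scale[OF alternating_linear])
qed

end

text \<open>Polarization: expand the vanishing value on the repeated argument u + w; the two terms
  with repeated arguments drop out.\<close>

lemma alternating_swap:
  assumes f: "alternating_at A p f" and u: "u \<in> tangent_space A p" and w: "w \<in> tangent_space A p"
  shows "f (u # w # vs) = - f (w # u # vs)"
proof (cases "set vs \<subseteq> tangent_space A p")
  case True
  define c where "c = chart_at A p"
  have c: "c \<in> A" "p \<in> fst c" using chart_at by (auto simp: c_def)
  \<comment> \<open>As a coordinate vector the sum is visibly tangent again.\<close>
  define z where "z = coord_vector A c (u c + w c) p"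
  have z: "z = (\<lambda>c'. u c' + w c')"
    unfolding z_def coord_vector_add[OF c]
    using tangent_eq_coord_vector[OF c u] tangent_eq_coord_vector[OF c w] by simp
  have zt: "z \<in> tangent_space A p" unfolding z_def by (rule coord_vector_tangent[OF c])
  have rep: "f (x # x # vs) = 0" for x
    using alternating_at_repeat[OF f, of 0 "x # x # vs" 1] by simp
  have add0: "f (z # y # vs) = f (u # y # vs) + f (w # y # vs)" if "y \<in> tangent_space A p" for y
    using alternating_at_addD[OF f, of "u # y # vs" 0 u w] u w that True by (simp add: z)
  have add1: "f (y # z # vs) = f (y # u # vs) + f (y # w # vs)" if "y \<in> tangent_space A p" for y
    using alternating_at_addD[OF f, of "y # u # vs" 1 u w] u w that True by (simp add: z)
  have "0 = f (z # z # vs)" by (simp add: rep)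
  also have "\<dots> = f (u # w # vs) + f (w # u # vs)"
    unfolding add0[OF zt] add1[OF u] add1[OF w] by (simp add: rep)
  finally show ?thesis by (metis eq_neg_iff_add_eq_0)
qed (use f in \<open>simp add: alternating_at_outside\<close>)

text \<open>More vectors than the dimension are linearly dependent, and expanding one of them in the
  others leaves only terms with repeated arguments. This bounds the degrees of forms, and so the
  weights of \<open>H_op\<close> from below.\<close>

lemma alternating_above_dimension:
  fixes f :: "('m, 'n) tangent list \<Rightarrow> 'v::real_vector"
  assumes f: "alternating_at A p f" and len: "length vs > CARD('n)"
  shows "f vs = 0"
proof (cases "set vs \<subseteq> tangent_space A p")
  case True
  define c where "c = chart_at A p"
  have c: "c \<in> A" "p \<in> fst c" using chart_at by (auto simp: c_def)
  define x where "x i = (vs ! i) c" for i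
  have x: "vs ! i = coord_vector A c (x i) p" if "i < length vs" for i
    unfolding x_def using tangent_eq_coord_vector[OF c] True that nth_mem by blast
  show ?thesis
  \<comment> \<open>Linear dependence is a property of the set of component vectors, which may be
    small if components coincide; that case is an instance of repeated arguments.\<close>
  proof (cases "inj_on x {..<length vs}")
    case False
    then obtain i j where "i < length vs" "j < length vs" "i \<noteq> j" "x i = x j"
      by (auto simp: inj_on_def)
    then show ?thesis using alternating_at_repeat[OF f] x by metis
  next
    case inj: True
    have "card (x ` {..<length vs}) > DIM(real ^ 'n)"
      using len by (simp add: card_image[OF inj])
    then have "dependent (x ` {..<length vs})" by (rule dependent_biggerset)
    then obtain i where i: "i < length vs" and "x i \<in> span (x ` {..<length vs} - {x i})"
      by (auto simp: dependent_def)
    then obtain r where r: "x i = (\<Sum>y\<in>x ` {..<length vs} - {x i}. r y *\<^sub>R y)"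
      by (auto simp: span_finite)
    let ?g = "\<lambda>y. f (vs[i := coord_vector A c y p])"
    have lin: "linear ?g" by (rule alternating_linear[OF f c True i])
    have "?g (x j) = 0" if "j < length vs" "x j \<noteq> x i" for j
    proof -
      have "j \<noteq> i" using that by auto
      then show ?thesis using that i
        by (intro alternating_at_repeat[OF f, of i _ j]) (auto simp: x)
    qed
    then have "?g (x i) = 0"
      by (subst r, simp only: linear_sum[OF lin] linear_scale[OF lin]) (fastforce intro!: sum.neutral)
    moreover have "vs[i := coord_vector A c (x i) p] = vs"
      using x[OF i] by (metis list_update_id)
    ultimately show ?thesis by simp
  qed
qed (use f in \<open>simp add: alternating_at_outside\<close>)

end

section \<open>Wedge products\<close>

text \<open>For a list \<open>v # vs\<close>, this splits the shuffles by whether the head goes to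
  the first or to the second factor.\<close>

lemma sum_Pow_lessThan_Suc:
  "(\<Sum>S\<in>Pow {..<Suc n}. g S) = (\<Sum>S\<in>Pow {..<n}. g (insert 0 (Suc ` S)) + g (Suc ` S))"
proof -
  have P: "Pow (Suc ` {..<n}) = image Suc ` Pow {..<n}"
    by (simp add: image_Pow_surj)
  have inj: "inj_on (image Suc) (Pow {..<n})" "inj_on (insert 0) (image Suc ` Pow {..<n})"
    by (auto simp: inj_on_def)
  have "(\<Sum>S\<in>Pow {..<Suc n}. g S) =
      (\<Sum>S\<in>image Suc ` Pow {..<n}. g S) + (\<Sum>S\<in>insert 0 ` image Suc ` Pow {..<n}. g S)"
    unfolding lessThan_Suc_eq_insert_0 Pow_insert P
    by (rule sum.union_disjoint) auto
  then show ?thesis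
    by (simp only: sum.reindex[OF inj(1)] sum.reindex[OF inj(2)] comp_def sum.distrib add.commute)
qed

definition inversions :: "nat \<Rightarrow> nat set \<Rightarrow> (nat \<times> nat) set" where
  "inversions n S = {(i, j). i \<in> S \<and> j \<in> {..<n} - S \<and> j < i}"

text \<open>A head that goes to the first factor stays in front and overtakes nothing.\<close>

lemma inversions_insert_0:
  "card (inversions (Suc n) (insert 0 (Suc ` S))) = card (inversions n S)"
proof -
  have "inversions (Suc n) (insert 0 (Suc ` S)) = map_prod Suc Suc ` inversions n S" (is "?L = ?R")
  proof
    show "?L \<subseteq> ?R"
    proof (clarify)
      fix i j assume "(i, j) \<in> ?L"
      then show "(i, j) \<in> ?R"
        by (cases i; cases j) (force simp: inversions_def)+
    qed
  qed (auto simp: inversions_def)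
  then show ?thesis by (simp add: card_image prod.inj_map inj_on_subset[OF _ subset_UNIV])
qed

text \<open>If the head goes to the second factor, every element of \<open>S\<close> has to pass it,
  which adds one inversion each.\<close>

lemma inversions_Suc_image:
  assumes "S \<subseteq> {..<n}"
  shows "card (inversions (Suc n) (Suc ` S)) = card (inversions n S) + card S"
proof -
  have fin: "finite S" using assms finite_subset by blast
  have "inversions n S \<subseteq> S \<times> {..<n}" by (auto simp: inversions_def)
  then have fin': "finite (inversions n S)" using fin finite_subset by blast
  have "inversions (Suc n) (Suc ` S) = map_prod Suc Suc ` inversions n S \<union> (\<lambda>i. (Suc i, 0)) ` S"
    (is "?L = ?R")
  proof
    show "?L \<subseteq> ?R"
    proof (clarify)
      fix i j assume "(i, j) \<in> ?L" "(i, j) \<notin> (\<lambda>i. (Suc i, 0)) ` S"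
      then show "(i, j) \<in> map_prod Suc Suc ` inversions n S"
        by (cases i; cases j) (force simp: inversions_def)+
    qed
  qed (auto simp: inversions_def)
  moreover have "card (map_prod Suc Suc ` inversions n S \<union> (\<lambda>i. (Suc i, 0)) ` S) =
      card (map_prod Suc Suc ` inversions n S) + card ((\<lambda>i. (Suc i, 0::nat)) ` S)"
    using fin fin' by (intro card_Un_disjoint) auto
  moreover have "card ((\<lambda>i. (Suc i, 0::nat)) ` S) = card S"
    by (intro card_image) (simp add: inj_on_def)
  ultimately show ?thesis
    by (simp add: card_image prod.inj_map inj_on_subset[OF _ subset_UNIV])
qed

lemma wedge_eq:
  "wedge \<alpha> \<psi> p vs = (\<Sum>S\<in>Pow {..<length vs}.
     ((-1) ^ card (inversions (length vs) S) * \<alpha> p (nths vs S)) *\<^sub>R \<psi> p (nths vs (- S)))"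
  by (simp add: wedge_def inversions_def)

lemma length_nths_subset: "S \<subseteq> {..<length vs} \<Longrightarrow> length (nths vs S) = card S"
  by (simp add: length_nths) (metis (no_types, lifting) Collect_mem_eq Collect_cong lessThan_iff subsetD)

text \<open>Prepending \<open>v\<close> is the interior product with \<open>v\<close>. Its antiderivation rule is a recursion for the
  wedge product which makes any further use of shuffles unnecessary.\<close>

lemma wedge_Cons:
  assumes "\<And>vs. length vs \<noteq> k \<Longrightarrow> \<alpha> p vs = 0"
  shows "wedge \<alpha> \<psi> p (v # vs) = wedge (\<lambda>p vs. \<alpha> p (v # vs)) \<psi> p vs +
    (-1) ^ k *\<^sub>R wedge \<alpha> (\<lambda>p vs. \<psi> p (v # vs)) p vs"
proof -
  let ?c = "\<lambda>S. (-1) ^ card (inversions (length vs) S) :: real"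
  have "wedge \<alpha> \<psi> p (v # vs) = (\<Sum>S\<in>Pow {..<length vs}.
      (?c S * \<alpha> p (v # nths vs S)) *\<^sub>R \<psi> p (nths vs (- S)) +
      (-1) ^ k *\<^sub>R (?c S * \<alpha> p (nths vs S)) *\<^sub>R \<psi> p (v # nths vs (- S)))"
    unfolding wedge_eq list.size add_Suc_right add_0_right sum_Pow_lessThan_Suc
  proof (intro sum.cong refl arg_cong2[where f = "(+)"], goal_cases)
    case (1 S)
    have "{j. Suc j \<in> insert 0 (Suc ` S)} = S" "{j. Suc j \<in> - insert 0 (Suc ` S)} = - S" by auto
    then show ?case by (simp add: inversions_insert_0 nths_Cons)
  next
    case (2 S)
    have "{j. Suc j \<in> Suc ` S} = S" "{j. Suc j \<in> - (Suc ` S)} = - S" "0 \<notin> Suc ` S" by auto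
    \<comment> \<open>The sign contributed by the head depends on \<open>card S\<close>; since
      \<alpha> has degree \<open>k\<close>, only subsets of that size contribute, and the sign can
      be taken out of the sum.\<close>
    moreover have "card S = k" if "\<alpha> p (nths vs S) \<noteq> 0"
      using assms[of "nths vs S"] that 2 length_nths_subset[of S vs] by auto
    ultimately show ?case
      using 2 by (cases "\<alpha> p (nths vs S) = 0")
        (simp_all add: inversions_Suc_image nths_Cons power_add ac_simps)
  qed
  then show ?thesis by (simp add: wedge_eq sum.distrib scaleR_sum_right)
qed

lemma wedge_degree_0:
  assumes "\<And>vs. length vs \<noteq> 0 \<Longrightarrow> \<alpha> p vs = 0"
  shows "wedge \<alpha> \<psi> p vs = \<alpha> p [] *\<^sub>R \<psi> p vs"
proof -
  have "\<alpha> p (nths vs S) = 0" if "S \<subseteq> {..<length vs}" "S \<noteq> {}" for S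
    using that finite_subset[OF that(1)] by (intro assms) (simp add: length_nths_subset)
  then have "wedge \<alpha> \<psi> p vs = (\<Sum>S\<in>{{}}.
      ((-1) ^ card (inversions (length vs) S) * \<alpha> p (nths vs S)) *\<^sub>R \<psi> p (nths vs (- S)))"
    unfolding wedge_eq by (intro sum.mono_neutral_right) auto
  then show ?thesis by (simp add: inversions_def nths_all)
qed

lemma wedge_cong:
  assumes "\<And>us. set us \<subseteq> set vs \<Longrightarrow> \<alpha> p us = \<alpha>' p us"
    and "\<And>us. set us \<subseteq> set vs \<Longrightarrow> \<psi> p us = \<psi>' p us"
  shows "wedge \<alpha> \<psi> p vs = wedge \<alpha>' \<psi>' p vs"
  unfolding wedge_eq using assms by (simp add: set_nths_subset)

lemma wedge_sum_right:
  "wedge \<alpha> (\<lambda>p vs. \<Sum>i\<in>I. r i *\<^sub>R \<psi> i p vs) p vs = (\<Sum>i\<in>I. r i *\<^sub>R wedge \<alpha> (\<psi> i) p vs)"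
  unfolding wedge_eq scaleR_sum_right by (subst sum.swap) (simp add: ac_simps)

lemma wedge_sum_left:
  "wedge (\<lambda>p vs. \<Sum>i\<in>I. r i * \<alpha> i p vs) \<psi> p vs = (\<Sum>i\<in>I. r i *\<^sub>R wedge (\<alpha> i) \<psi> p vs)"
  unfolding wedge_eq sum_distrib_left scaleR_sum_left scaleR_sum_right
  by (subst sum.swap) (simp add: ac_simps)

lemma wedge_minus_right: "wedge \<alpha> (\<lambda>p vs. - \<psi> p vs) p vs = - wedge \<alpha> \<psi> p vs"
  by (simp add: wedge_eq sum_negf)

text \<open>In every shuffle, a non-tangent entry ends up among the arguments of one of the two
  factors.\<close>

lemma wedge_outside:
  assumes "alternating_at A p (\<alpha> p)" "alternating_at A p (\<psi> p)" "\<not> set vs \<subseteq> tangent_space A p"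
  shows "wedge \<alpha> \<psi> p vs = 0"
proof -
  have "\<alpha> p (nths vs S) = 0 \<or> \<psi> p (nths vs (- S)) = 0" for S
  proof -
    obtain i where i: "i < length vs" "vs ! i \<notin> tangent_space A p"
      using assms(3) by (metis in_set_conv_nth subsetI)
    then have "\<not> set (nths vs S) \<subseteq> tangent_space A p \<or> \<not> set (nths vs (- S)) \<subseteq> tangent_space A p"
      by (cases "i \<in> S") (auto simp: set_nths)
    then show ?thesis
      using alternating_at_outside[OF assms(1)] alternating_at_outside[OF assms(2)] by blast
  qed
  then show ?thesis unfolding wedge_eq by (intro sum.neutral) auto
qed

section \<open>The Poisson bivector\<close>

lemma sum_swap_reverse4:
  "(\<Sum>i\<in>I. \<Sum>j\<in>J. \<Sum>k\<in>K. \<Sum>l\<in>L. t i j k l) = (\<Sum>l\<in>L. \<Sum>k\<in>K. \<Sum>j\<in>J. \<Sum>i\<in>I. t i j k l)"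
proof -
  have "(\<Sum>i\<in>I. \<Sum>j\<in>J. \<Sum>k\<in>K. \<Sum>l\<in>L. t i j k l) = (\<Sum>i\<in>I. \<Sum>k\<in>K. \<Sum>j\<in>J. \<Sum>l\<in>L. t i j k l)"
    by (rule sum.cong[OF refl sum.swap])
  also have "\<dots> = (\<Sum>k\<in>K. \<Sum>i\<in>I. \<Sum>j\<in>J. \<Sum>l\<in>L. t i j k l)" by (rule sum.swap)
  also have "\<dots> = (\<Sum>k\<in>K. \<Sum>i\<in>I. \<Sum>l\<in>L. \<Sum>j\<in>J. t i j k l)"
    by (intro sum.cong refl) (rule sum.swap)
  also have "\<dots> = (\<Sum>k\<in>K. \<Sum>l\<in>L. \<Sum>i\<in>I. \<Sum>j\<in>J. t i j k l)"
    by (rule sum.cong[OF refl sum.swap])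
  also have "\<dots> = (\<Sum>l\<in>L. \<Sum>k\<in>K. \<Sum>i\<in>I. \<Sum>j\<in>J. t i j k l)" by (rule sum.swap)
  also have "\<dots> = (\<Sum>l\<in>L. \<Sum>k\<in>K. \<Sum>j\<in>J. \<Sum>i\<in>I. t i j k l)"
    by (intro sum.cong refl) (rule sum.swap)
  finally show ?thesis .
qed

context atlas
begin

abbreviation frame :: "('m, 'n) chart \<Rightarrow> 'n \<Rightarrow> 'm \<Rightarrow> ('m, 'n) tangent" where
  "frame c i p \<equiv> coord_vector A c (axis i 1) p"

lemma alternating_expand_Cons:
  assumes f: "alternating_at A p f" and c: "c \<in> A" "p \<in> fst c"
  shows "f (coord_vector A c x p # us) = (\<Sum>k\<in>UNIV. (x $ k) *\<^sub>R f (frame c k p # us))"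
proof (cases "set us \<subseteq> tangent_space A p")
  case True
  then show ?thesis
    using alternating_expand[OF f c, of "coord_vector A c x p # us" 0 x]
    by (simp add: coord_vector_tangent[OF c])
next
  case False
  then have "f (v # us) = 0" for v using alternating_at_outside[OF f, of "v # us"] by auto
  then show ?thesis by simp
qed

text \<open>In \<open>Lambda_op\<close> the chart varies with the point in an uncontrolled way, so
  smoothness cannot be read off from it. The same formula in a fixed chart has smooth coefficients;
  independence of the chart connects the two.\<close>

definition Lambda_chart ::
  "('m, 'n, real) form \<Rightarrow> ('m, 'n) chart \<Rightarrow> 'm \<Rightarrow> (('m, 'n) tangent list \<Rightarrow> 'v::real_vector) \<Rightarrow>
    ('m, 'n) tangent list \<Rightarrow> 'v" where
  "Lambda_chart \<omega> c p f vs = (1/2) *\<^sub>R (\<Sum>i\<in>UNIV. \<Sum>j\<in>UNIV.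
     matrix_inv (omega_matrix A \<omega> c p) $ i $ j *\<^sub>R f (frame c j p # frame c i p # vs))"

lemma Lambda_op_eq: "Lambda_op A \<omega> \<psi> p vs = Lambda_chart \<omega> (chart_at A p) p (\<psi> p) vs"
  by (simp add: Lambda_op_def Lambda_chart_def interior_product_def Let_def)

end

locale symplectic_atlas = atlas A
  for A :: "('m::t2_space, 'n::finite) chart set" +
  fixes \<omega> :: "('m, 'n, real) form"
  assumes symplectic: "symplectic_form A \<omega>"
begin

lemma omega_alternating: "alternating_at A p (\<omega> p)"
  using symplectic by (simp add: symplectic_form_def forms_def)

lemma omega_degree: "length vs \<noteq> 2 \<Longrightarrow> \<omega> p vs = 0"
  using symplectic by (simp add: symplectic_form_def of_degree_def)

context
  fixes c :: "('m, 'n) chart" and p :: 'm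
  assumes c: "c \<in> A" "p \<in> fst c"
begin

lemma omega_matrix_antisym: "omega_matrix A \<omega> c p $ j $ i = - omega_matrix A \<omega> c p $ i $ j"
  unfolding omega_matrix_def vec_lambda_beta
  by (rule alternating_swap[OF omega_alternating coord_vector_tangent[OF c] coord_vector_tangent[OF c]])

lemma omega_frame:
  assumes "w \<in> tangent_space A p"
  shows "\<omega> p [frame c i p, w] = (\<Sum>k\<in>UNIV. omega_matrix A \<omega> c p $ i $ k * w c $ k)"
proof -
  have "\<omega> p [frame c i p, w] = \<omega> p [frame c i p, coord_vector A c (w c) p]"
    by (rule arg_cong[OF tangent_eq_coord_vector[OF c assms], where f = "\<lambda>w. \<omega> p [frame c i p, w]"])
  also have "\<dots> = (\<Sum>k\<in>UNIV. w c $ k * \<omega> p [frame c i p, frame c k p])"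
    using alternating_expand_Cons[OF alternating_at_Cons[OF omega_alternating coord_vector_tangent[OF c]] c,
        of _ "w c" "[]"]
    by simp
  finally show ?thesis by (simp add: omega_matrix_def mult.commute)
qed

text \<open>A kernel vector of the matrix gives a tangent vector that pairs to zero with the frame,
  hence with everything, and nondegeneracy makes it zero.\<close>

lemma invertible_omega_matrix: "invertible (omega_matrix A \<omega> c p)"
proof -
  have "x = 0" if x: "omega_matrix A \<omega> c p *v x = 0" for x
  proof -
    let ?X = "coord_vector A c x p"
    have X: "?X \<in> tangent_space A p" by (rule coord_vector_tangent[OF c])
    have "\<omega> p [frame c i p, ?X] = 0" for i
      using arg_cong[OF x, of "\<lambda>y. y $ i"]
      by (simp add: omega_frame[OF X] coord_vector_component[OF c] matrix_vector_mult_def)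
    then have "\<omega> p [w, ?X] = 0" if "w \<in> tangent_space A p" for w
      by (subst tangent_eq_coord_vector[OF c that], subst alternating_expand_Cons[OF omega_alternating c])
        simp
    then have "\<omega> p [?X, w] = 0" if "w \<in> tangent_space A p" for w
      using alternating_swap[OF omega_alternating X that] that by simp
    then have "?X = 0"
      using symplectic X unfolding symplectic_form_def by blast
    then show "x = 0"
      using coord_vector_component[OF c, of x] by simp
  qed
  then show ?thesis
    using matrix_left_invertible_ker invertible_left_inverse by blast
qed

lemma omega_matrix_inv_left: "matrix_inv (omega_matrix A \<omega> c p) ** omega_matrix A \<omega> c p = mat 1"
  by (rule iffD1[OF matrix_left_right_inverse matrix_inv_right[OF invertible_omega_matrix]])

text \<open>Transposing \<open>?M ** ?P = mat 1\<close> shows that \<open>- transpose ?P\<close> is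
  a left inverse of the antisymmetric matrix \<open>?M\<close>, so it equals
  \<open>?P\<close>.\<close>

lemma omega_matrix_inv_antisym:
  "matrix_inv (omega_matrix A \<omega> c p) $ j $ i = - matrix_inv (omega_matrix A \<omega> c p) $ i $ j"
proof -
  let ?M = "omega_matrix A \<omega> c p" and ?P = "matrix_inv (omega_matrix A \<omega> c p)"
  have "transpose ?M = - ?M"
    by (simp add: vec_eq_iff transpose_def omega_matrix_antisym[symmetric])
  moreover have "transpose ?P ** transpose ?M = mat 1"
    by (simp add: matrix_transpose_mul[symmetric] matrix_inv_right[OF invertible_omega_matrix] transpose_mat)
  ultimately have "(- transpose ?P) ** ?M = mat 1"
    by (simp add: matrix_matrix_mult_def vec_eq_iff)
  then have "(- transpose ?P) ** (?M ** ?P) = ?P"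
    by (simp add: matrix_mul_assoc)
  then have "- transpose ?P = ?P"
    by (simp add: matrix_inv_right[OF invertible_omega_matrix])
  then have "(- transpose ?P) $ j $ i = ?P $ j $ i" by simp
  then show ?thesis by (simp add: transpose_def)
qed

end

text \<open>With the Jacobian \<open>J\<close> of the coordinate change, the matrices of \<omega>
  satisfy \<open>M = transpose J ** M' ** J\<close>, so their inverses transform like the components
  of a bivector, \<open>matrix_inv M' = J ** matrix_inv M ** transpose J\<close>. This absorbs the
  two factors \<open>J\<close> that come from expanding the frame vectors.\<close>

lemma Lambda_chart_independent:
  assumes f: "alternating_at A p f" and c: "c \<in> A" "p \<in> fst c" and c': "c' \<in> A" "p \<in> fst c'"
  shows "Lambda_chart \<omega> c p f vs = Lambda_chart \<omega> c' p f vs"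
proof -
  define J :: "real ^ 'n ^ 'n" where "J = (\<chi> k i. frame c i p c' $ k)"
  define M where "M = omega_matrix A \<omega> c p"
  define M' where "M' = omega_matrix A \<omega> c' p"
  have expand: "g (frame c i p # us) = (\<Sum>k\<in>UNIV. J $ k $ i *\<^sub>R g (frame c' k p # us))"
    if "alternating_at A p g" for g :: "('m, 'n) tangent list \<Rightarrow> 'w::real_vector" and i us
  proof -
    have "g (frame c i p # us) = g (coord_vector A c' (frame c i p c') p # us)"
      by (rule arg_cong[OF tangent_eq_coord_vector[OF c' coord_vector_tangent[OF c]], where f = "\<lambda>v. g (v # us)"])
    then show ?thesis
      using alternating_expand_Cons[OF that c', of "frame c i p c'" us] by (simp only: J_def vec_lambda_beta)
  qed
  have expand2: "g (frame c j p # frame c i p # us) =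
      (\<Sum>l\<in>UNIV. \<Sum>k\<in>UNIV. (J $ l $ j * J $ k $ i) *\<^sub>R g (frame c' l p # frame c' k p # us))"
    if "alternating_at A p g" for g :: "('m, 'n) tangent list \<Rightarrow> 'w::real_vector" and i j us
    by (subst expand[OF that], subst expand[OF alternating_at_Cons[OF that coord_vector_tangent[OF c']]])
      (simp only: scaleR_sum_right scaleR_scaleR)
  have "(transpose J ** M' ** J) $ i $ j = M $ i $ j" for i j
  proof -
    have "(transpose J ** M' ** J) $ i $ j = (\<Sum>l\<in>UNIV. \<Sum>k\<in>UNIV. J $ k $ i * M' $ k $ l * J $ l $ j)"
      by (simp add: matrix_matrix_mult_def transpose_def sum_distrib_right)
    also have "\<dots> = (\<Sum>k\<in>UNIV. \<Sum>l\<in>UNIV. J $ k $ i * M' $ k $ l * J $ l $ j)" by (rule sum.swap)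
    also have "\<dots> = (\<Sum>k\<in>UNIV. \<Sum>l\<in>UNIV. (J $ k $ i * J $ l $ j) *\<^sub>R \<omega> p [frame c' k p, frame c' l p])"
      by (simp add: M'_def omega_matrix_def ac_simps)
    also have "\<dots> = M $ i $ j"
      unfolding M_def omega_matrix_def vec_lambda_beta by (rule expand2[OF omega_alternating, symmetric])
    finally show ?thesis .
  qed
  then have "transpose J ** M' ** J = M" by (simp add: vec_eq_iff)
  then have "transpose J ** (M' ** (J ** matrix_inv M)) = mat 1"
    using matrix_inv_right[OF invertible_omega_matrix[OF c]] by (simp add: M_def matrix_mul_assoc)
  \<comment> \<open>A one-sided inverse of a square matrix is two-sided. This carries
    \<open>transpose J\<close> to the other end without inverting \<open>J\<close>.\<close>
  then have "M' ** (J ** matrix_inv M) ** transpose J = mat 1"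
    by (rule iffD1[OF matrix_left_right_inverse])
  then have "M' ** (J ** matrix_inv M ** transpose J) = mat 1"
    by (simp only: matrix_mul_assoc)
  then have "matrix_inv M' ** (M' ** (J ** matrix_inv M ** transpose J)) = matrix_inv M'"
    by (simp only: matrix_mul_rid)
  then have P': "matrix_inv M' = J ** matrix_inv M ** transpose J"
    unfolding matrix_mul_assoc[of "matrix_inv M'" M'] omega_matrix_inv_left[OF c', folded M'_def] by simp
  have "(\<Sum>i\<in>UNIV. \<Sum>j\<in>UNIV. matrix_inv M $ i $ j *\<^sub>R f (frame c j p # frame c i p # vs)) =
      (\<Sum>i\<in>UNIV. \<Sum>j\<in>UNIV. \<Sum>l\<in>UNIV. \<Sum>k\<in>UNIV.
        (matrix_inv M $ i $ j * J $ l $ j * J $ k $ i) *\<^sub>R f (frame c' l p # frame c' k p # vs))"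
    unfolding expand2[OF f] scaleR_sum_right scaleR_scaleR by (simp only: mult.assoc)
  also have "\<dots> = (\<Sum>k\<in>UNIV. \<Sum>l\<in>UNIV. \<Sum>j\<in>UNIV. \<Sum>i\<in>UNIV.
        (matrix_inv M $ i $ j * J $ l $ j * J $ k $ i) *\<^sub>R f (frame c' l p # frame c' k p # vs))"
    by (rule sum_swap_reverse4)
  also have "\<dots> = (\<Sum>k\<in>UNIV. \<Sum>l\<in>UNIV. matrix_inv M' $ k $ l *\<^sub>R f (frame c' l p # frame c' k p # vs))"
    unfolding P' matrix_matrix_mult_def transpose_def vec_lambda_beta scaleR_sum_left sum_distrib_right
    by (simp only: mult_ac)
  finally show ?thesis unfolding Lambda_chart_def M_def M'_def by (rule arg_cong)
qed

end

section \<open>The commutator of \<Lambda> and \<open>L\<close> at a point\<close>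

context atlas begin

text \<open>The coordinate differential \<open>dx_j\<close> of the chart. It is not cut off to zero
  on non-tangent vectors, as it is evaluated only on tangent ones.\<close>

definition coord_form :: "('m, 'n) chart \<Rightarrow> 'n \<Rightarrow> ('m, 'n, real) form" where
  "coord_form c j = (\<lambda>p vs. if length vs = 1 then hd vs c $ j else 0)"

text \<open>The sum of all \<open>dx_j\<close> wedged with the contraction by the j-th frame vector
  counts the degree. Splitting off the head \<open>v\<close> of the list yields f (v # vs) by
  expansion in the frame, plus the same sum for the contraction of \<open>f\<close> with
  \<open>v\<close>: the sign from moving \<open>v\<close> past \<open>dx_j\<close> cancels the one
  from swapping \<open>v\<close> with the frame vector.\<close>

lemma sum_coord_form_contraction:
  assumes c: "c \<in> A" "p \<in> fst c"
    and f: "alternating_at A p f" and vs: "set vs \<subseteq> tangent_space A p"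
  shows "(\<Sum>j\<in>UNIV. wedge (coord_form c j) (\<lambda>q us. f (frame c j p # us)) p vs) =
    real (length vs) *\<^sub>R f vs"
  using f vs
proof (induction vs arbitrary: f)
  case Nil
  show ?case by (simp add: wedge_eq coord_form_def)
next
  case (Cons v vs)
  then have f: "alternating_at A p f" and v: "v \<in> tangent_space A p"
    and vs: "set vs \<subseteq> tangent_space A p" by auto
  have swap: "(\<lambda>q us. f (frame c j p # v # us)) = (\<lambda>q us. - f (v # frame c j p # us))" for j
    by (intro ext alternating_swap[OF f coord_vector_tangent[OF c] v])
  have "wedge (coord_form c j) (\<lambda>q us. f (frame c j p # us)) p (v # vs) =
      (v c $ j) *\<^sub>R f (frame c j p # vs) +
      wedge (coord_form c j) (\<lambda>q us. f (v # frame c j p # us)) p vs" for j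
  proof -
    have "wedge (coord_form c j) (\<lambda>q us. f (frame c j p # us)) p (v # vs) =
        wedge (\<lambda>q us. coord_form c j q (v # us)) (\<lambda>q us. f (frame c j p # us)) p vs +
        (-1) ^ 1 *\<^sub>R wedge (coord_form c j) (\<lambda>q us. f (frame c j p # v # us)) p vs"
      by (rule wedge_Cons) (simp add: coord_form_def)
    also have "wedge (\<lambda>q us. coord_form c j q (v # us)) (\<lambda>q us. f (frame c j p # us)) p vs =
        coord_form c j p [v] *\<^sub>R f (frame c j p # vs)"
      by (rule wedge_degree_0) (simp add: coord_form_def)
    finally show ?thesis
      by (simp add: swap wedge_minus_right) (simp add: coord_form_def)
  qed
  moreover have "(\<Sum>j\<in>UNIV. (v c $ j) *\<^sub>R f (frame c j p # vs)) = f (v # vs)"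
    unfolding alternating_expand_Cons[OF f c, symmetric] tangent_eq_coord_vector[OF c v, symmetric] ..
  ultimately show ?case
    using Cons.IH[OF alternating_at_Cons[OF f v] vs] by (simp add: sum.distrib scaleR_add_left)
qed

end

context symplectic_atlas begin

lemma alternating_Lambda_chart:
  assumes f: "alternating_at A p f" and c: "c \<in> A" "p \<in> fst c"
  shows "alternating_at A p (Lambda_chart \<omega> c p f)"
  unfolding Lambda_chart_def
  by (intro alternating_at_length_scaleR[where r = "\<lambda>_. _"] alternating_at_sum
      alternating_at_Cons[OF alternating_at_Cons[OF f]] coord_vector_tangent[OF c])

text \<open>Moving two contractions through the wedge product by the antiderivation rule gives four
  terms. Both contractions on \<omega> produce the trace of \<open>P ** M\<close>, which is the
  dimension; both on \<psi> produce the wedge of \<omega> with \<Lambda>\<psi>; the two mixed terms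
  agree after summation and each yields minus the degree.\<close>

lemma Lambda_wedge_omega:
  assumes f: "alternating_at A p (\<psi> p)"
  shows "Lambda_op A \<omega> (wedge \<omega> \<psi>) p vs =
    wedge \<omega> (Lambda_op A \<omega> \<psi>) p vs + (real CARD('n) / 2 - real (length vs)) *\<^sub>R \<psi> p vs"
proof (cases "set vs \<subseteq> tangent_space A p")
  case vs: True
  define c where "c = chart_at A p"
  have c: "c \<in> A" "p \<in> fst c" using chart_at by (auto simp: c_def)
  define M where "M = omega_matrix A \<omega> c p"
  define P where "P = matrix_inv M"
  have anti: "P $ i $ j = - P $ j $ i" for i j
    unfolding P_def M_def by (rule omega_matrix_inv_antisym[OF c])
  define B where "B i = frame c i p" for i
  have B: "B i \<in> tangent_space A p" for i unfolding B_def by (rule coord_vector_tangent[OF c])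
  define W where "W i j = wedge (\<lambda>q us. \<omega> q (B i # us)) (\<lambda>q us. \<psi> q (B j # us)) p vs" for i j
  define Z where "Z i j = wedge \<omega> (\<lambda>q us. \<psi> q (B j # B i # us)) p vs" for i j
  have "wedge \<omega> \<psi> p (B j # B i # vs) = M $ j $ i *\<^sub>R \<psi> p vs - W j i + (W i j + Z i j)" for i j
  proof -
    have "wedge \<omega> \<psi> p (B j # B i # vs) = wedge (\<lambda>q us. \<omega> q (B j # us)) \<psi> p (B i # vs) +
        (-1) ^ 2 *\<^sub>R wedge \<omega> (\<lambda>q us. \<psi> q (B j # us)) p (B i # vs)"
      by (rule wedge_Cons) (rule omega_degree)
    also have "wedge (\<lambda>q us. \<omega> q (B j # us)) \<psi> p (B i # vs) =
        wedge (\<lambda>q us. \<omega> q (B j # B i # us)) \<psi> p vs + (-1) ^ 1 *\<^sub>R W j i"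
      unfolding W_def by (rule wedge_Cons) (simp add: omega_degree)
    also have "wedge (\<lambda>q us. \<omega> q (B j # B i # us)) \<psi> p vs = \<omega> p [B j, B i] *\<^sub>R \<psi> p vs"
      by (rule wedge_degree_0) (simp add: omega_degree)
    also have "wedge \<omega> (\<lambda>q us. \<psi> q (B j # us)) p (B i # vs) = W i j + (-1) ^ 2 *\<^sub>R Z i j"
      unfolding W_def Z_def by (rule wedge_Cons) (rule omega_degree)
    also have "\<omega> p [B j, B i] = M $ j $ i" by (simp add: M_def omega_matrix_def B_def)
    finally show ?thesis by simp
  qed
  then have "Lambda_op A \<omega> (wedge \<omega> \<psi>) p vs = (1/2) *\<^sub>R (\<Sum>i\<in>UNIV. \<Sum>j\<in>UNIV.
      P $ i $ j *\<^sub>R (M $ j $ i *\<^sub>R \<psi> p vs - W j i + (W i j + Z i j)))"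
    by (simp add: Lambda_op_eq Lambda_chart_def P_def M_def B_def c_def)
  also have "(\<Sum>i\<in>UNIV. \<Sum>j\<in>UNIV. P $ i $ j *\<^sub>R (M $ j $ i *\<^sub>R \<psi> p vs - W j i + (W i j + Z i j))) =
      (\<Sum>i\<in>UNIV. \<Sum>j\<in>UNIV. P $ i $ j * M $ j $ i) *\<^sub>R \<psi> p vs - (\<Sum>i\<in>UNIV. \<Sum>j\<in>UNIV. P $ i $ j *\<^sub>R W j i)
      + ((\<Sum>i\<in>UNIV. \<Sum>j\<in>UNIV. P $ i $ j *\<^sub>R W i j) + (\<Sum>i\<in>UNIV. \<Sum>j\<in>UNIV. P $ i $ j *\<^sub>R Z i j))"
    by (simp add: scaleR_add_right scaleR_diff_right sum.distrib sum_subtractf scaleR_sum_left)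
  also have "(\<Sum>i\<in>UNIV. \<Sum>j\<in>UNIV. P $ i $ j * M $ j $ i) = real CARD('n)"
  proof -
    have "(\<Sum>j\<in>UNIV. P $ i $ j * M $ j $ i) = (P ** M) $ i $ i" for i
      by (simp add: matrix_matrix_mult_def)
    then show ?thesis
      by (simp add: P_def M_def omega_matrix_inv_left[OF c] mat_def)
  qed
  \<comment> \<open>Antisymmetry of \<open>P\<close> reverses the sign, so the mixed terms, which
    enter with opposite signs, add up instead of cancelling.\<close>
  also have "(\<Sum>i\<in>UNIV. \<Sum>j\<in>UNIV. P $ i $ j *\<^sub>R W j i) = - (\<Sum>i\<in>UNIV. \<Sum>j\<in>UNIV. P $ i $ j *\<^sub>R W i j)"
  proof -
    have "(\<Sum>i\<in>UNIV. \<Sum>j\<in>UNIV. P $ i $ j *\<^sub>R W j i) = (\<Sum>j\<in>UNIV. \<Sum>i\<in>UNIV. P $ i $ j *\<^sub>R W j i)"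
      by (rule sum.swap)
    also have "\<dots> = (\<Sum>j\<in>UNIV. \<Sum>i\<in>UNIV. - (P $ j $ i *\<^sub>R W j i))"
      by (intro sum.cong refl) (subst anti, simp)
    finally show ?thesis by (simp add: sum_negf)
  qed
  \<comment> \<open>The inverse matrix turns the contractions of \<omega> with the frame into
    \<open>- dx_j\<close>, again with a sign from antisymmetry, and what remains is the
    degree-counting sum.\<close>
  also have "(\<Sum>i\<in>UNIV. \<Sum>j\<in>UNIV. P $ i $ j *\<^sub>R W i j) = - (real (length vs) *\<^sub>R \<psi> p vs)"
  proof -
    have "(\<Sum>i\<in>UNIV. \<Sum>j\<in>UNIV. P $ i $ j *\<^sub>R W i j) = (\<Sum>j\<in>UNIV. \<Sum>i\<in>UNIV. P $ i $ j *\<^sub>R W i j)"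
      by (rule sum.swap)
    also have "\<dots> = (\<Sum>j\<in>UNIV. wedge (\<lambda>q us. \<Sum>i\<in>UNIV. P $ i $ j * \<omega> q (B i # us))
        (\<lambda>q us. \<psi> q (B j # us)) p vs)"
      unfolding W_def wedge_sum_left ..
    also have "\<dots> = (\<Sum>j\<in>UNIV. wedge (\<lambda>q us. - coord_form c j q us)
        (\<lambda>q us. \<psi> p (B j # us)) p vs)"
    proof (intro sum.cong refl wedge_cong)
      fix j us assume "set us \<subseteq> set vs"
      with vs have us: "set us \<subseteq> tangent_space A p" by blast
      show "(\<Sum>i\<in>UNIV. P $ i $ j * \<omega> p (B i # us)) = - coord_form c j p us"
      proof (cases "length us = 1")
        case True
        then obtain w where [simp]: "us = [w]" by (auto simp: length_Suc_conv)
        have "(\<Sum>i\<in>UNIV. P $ i $ j * \<omega> p [B i, w]) =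
            (\<Sum>i\<in>UNIV. \<Sum>k\<in>UNIV. - (P $ j $ i * M $ i $ k * w c $ k))"
          by (subst anti) (use us in \<open>simp add: B_def omega_frame[OF c] M_def sum_distrib_left mult.assoc sum_negf\<close>)
        also have "\<dots> = (\<Sum>k\<in>UNIV. \<Sum>i\<in>UNIV. - (P $ j $ i * M $ i $ k * w c $ k))"
          by (rule sum.swap)
        also have "\<dots> = - (\<Sum>k\<in>UNIV. (P ** M) $ j $ k * w c $ k)"
          by (simp add: matrix_matrix_mult_def sum_distrib_right sum_negf)
        also have "\<dots> = - (\<Sum>k\<in>UNIV. if j = k then w c $ k else 0)"
          by (intro arg_cong[where f = uminus] sum.cong refl)
            (simp add: P_def M_def omega_matrix_inv_left[OF c] mat_def)
        also have "\<dots> = - coord_form c j p us" by (simp add: coord_form_def)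
        finally show ?thesis by simp
      qed (simp add: omega_degree coord_form_def)
    qed
    also have "\<dots> = - (\<Sum>j\<in>UNIV. wedge (coord_form c j) (\<lambda>q us. \<psi> p (B j # us)) p vs)"
      by (simp add: wedge_eq sum_negf)
    finally show ?thesis
      unfolding B_def sum_coord_form_contraction[OF c f vs] .
  qed
  also have "(\<Sum>i\<in>UNIV. \<Sum>j\<in>UNIV. P $ i $ j *\<^sub>R Z i j) = 2 *\<^sub>R wedge \<omega> (Lambda_op A \<omega> \<psi>) p vs"
  proof -
    \<comment> \<open>The one-element sum and the factor 1 give each of the three nested layers the
      shape of \<open>wedge_sum_right\<close>.\<close>
    have "wedge \<omega> (Lambda_op A \<omega> \<psi>) p vs = wedge \<omega> (\<lambda>q us. \<Sum>u\<in>{()}. (1/2) *\<^sub>R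
        (\<Sum>i\<in>UNIV. 1 *\<^sub>R (\<Sum>j\<in>UNIV. P $ i $ j *\<^sub>R \<psi> q (B j # B i # us)))) p vs"
      by (rule wedge_cong) (simp_all add: Lambda_op_eq Lambda_chart_def P_def M_def B_def c_def)
    also have "\<dots> = (1/2) *\<^sub>R (\<Sum>i\<in>UNIV. \<Sum>j\<in>UNIV. P $ i $ j *\<^sub>R Z i j)"
      unfolding wedge_sum_right Z_def by simp
    finally show ?thesis by simp
  qed
  finally have "Lambda_op A \<omega> (wedge \<omega> \<psi>) p vs = wedge \<omega> (Lambda_op A \<omega> \<psi>) p vs +
      ((real CARD('n) / 2) *\<^sub>R \<psi> p vs - ((real (length vs) / 2) *\<^sub>R \<psi> p vs + (real (length vs) / 2) *\<^sub>R \<psi> p vs))"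
    by (simp add: scaleR_add_right scaleR_diff_right)
  then show ?thesis by (simp add: scaleR_diff_left flip: scaleR_add_left)
next
  case False
  define c where "c = chart_at A p"
  have c: "c \<in> A" "p \<in> fst c" using chart_at by (auto simp: c_def)
  have "wedge \<omega> \<psi> p (u # w # vs) = 0" for u w
    by (rule wedge_outside[of A p \<omega> \<psi>, OF omega_alternating f]) (use False in simp)
  moreover have "wedge \<omega> (Lambda_op A \<omega> \<psi>) p vs = 0"
    by (rule wedge_outside[of A p \<omega>, OF omega_alternating _ False])
      (use alternating_Lambda_chart[OF f c] in \<open>simp add: Lambda_op_eq[abs_def] c_def\<close>)
  ultimately show ?thesis
    using alternating_at_outside[OF f False] by (simp add: Lambda_op_eq Lambda_chart_def)
qed

end

section \<open>Representations of osp(1|2) from an odd square root of L\<close>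

text \<open>The intended instance is \<Lambda>, \<open>H\<close> and b times the induced operator on
  twisted forms, with \<open>M\<close> = m. All relations are restricted to \<open>W\<close>,
  outside which that operator is arbitrary. The two weight conditions are matched to each other: a
  shift by more than 2M carries every vector of the spanning set past the top weight.\<close>

locale osp_triple = vector_space sc
  for sc :: "complex \<Rightarrow> 'w \<Rightarrow> 'w::ab_group_add" +
  fixes W :: "'w set" and e h Q :: "'w \<Rightarrow> 'w" and M :: real
  assumes W: "subspace W"
    and maps [simp]: "x \<in> W \<Longrightarrow> e x \<in> W" "x \<in> W \<Longrightarrow> h x \<in> W" "x \<in> W \<Longrightarrow> Q x \<in> W"
    and add: "x \<in> W \<Longrightarrow> y \<in> W \<Longrightarrow> e (x + y) = e x + e y"
      "x \<in> W \<Longrightarrow> y \<in> W \<Longrightarrow> h (x + y) = h x + h y"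
      "x \<in> W \<Longrightarrow> y \<in> W \<Longrightarrow> Q (x + y) = Q x + Q y"
    and scale: "x \<in> W \<Longrightarrow> e (sc z x) = sc z (e x)"
      "x \<in> W \<Longrightarrow> h (sc z x) = sc z (h x)"
      "x \<in> W \<Longrightarrow> Q (sc z x) = sc z (Q x)"
    and h_e: "x \<in> W \<Longrightarrow> h (e x) = e (h x) + sc 2 (e x)"
    and h_Q: "x \<in> W \<Longrightarrow> h (Q x) = Q (h x) - Q x"
    and e_QQ: "x \<in> W \<Longrightarrow> e (Q (Q x)) = Q (Q (e x)) + h x"
    and weights_ge: "W \<subseteq> span {w \<in> W. \<exists>r\<ge>-M. h w = sc (of_real r) w}"
    and weights_le: "w \<in> W \<Longrightarrow> h w = sc (of_real r) w \<Longrightarrow> r > M \<Longrightarrow> w = 0"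
begin

lemma W_closed [simp]:
  "0 \<in> W" "x \<in> W \<Longrightarrow> y \<in> W \<Longrightarrow> x + y \<in> W" "x \<in> W \<Longrightarrow> y \<in> W \<Longrightarrow> x - y \<in> W"
  "x \<in> W \<Longrightarrow> - x \<in> W" "x \<in> W \<Longrightarrow> sc z x \<in> W"
  using W by (auto simp: subspace_0 subspace_add subspace_diff subspace_neg subspace_scale)

definition endo :: "('w \<Rightarrow> 'w) \<Rightarrow> bool" where
  "endo F \<longleftrightarrow> (\<forall>x\<in>W. F x \<in> W) \<and> (\<forall>x\<in>W. \<forall>y\<in>W. F (x + y) = F x + F y) \<and>
     (\<forall>x\<in>W. \<forall>z. F (sc z x) = sc z (F x))"

definition bracket :: "('w \<Rightarrow> 'w) \<Rightarrow> ('w \<Rightarrow> 'w) \<Rightarrow> 'w \<Rightarrow> 'w" where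
  "bracket F G x = F (G x) - G (F x)"

lemma endo_rules:
  assumes "endo F"
  shows "x \<in> W \<Longrightarrow> F x \<in> W" "x \<in> W \<Longrightarrow> y \<in> W \<Longrightarrow> F (x + y) = F x + F y"
    "x \<in> W \<Longrightarrow> F (sc z x) = sc z (F x)" "F 0 = 0" "x \<in> W \<Longrightarrow> F (- x) = - F x"
    "x \<in> W \<Longrightarrow> y \<in> W \<Longrightarrow> F (x - y) = F x - F y"
proof -
  show maps: "x \<in> W \<Longrightarrow> F x \<in> W"
    and add: "x \<in> W \<Longrightarrow> y \<in> W \<Longrightarrow> F (x + y) = F x + F y"
    and scale: "x \<in> W \<Longrightarrow> F (sc z x) = sc z (F x)" for x y z
    using assms by (auto simp: endo_def)
  show "F 0 = 0" using scale[of 0 0] by simp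
  show minus: "x \<in> W \<Longrightarrow> F (- x) = - F x" for x using scale[of x "-1"] by simp
  show "x \<in> W \<Longrightarrow> y \<in> W \<Longrightarrow> F (x - y) = F x - F y" using add[of x "- y"] minus[of y] by simp
qed

lemma endo_basic: "endo e" "endo h" "endo Q"
  by (auto simp: endo_def add scale)

lemma endo_bracket: "endo F \<Longrightarrow> endo G \<Longrightarrow> endo (bracket F G)"
  by (simp add: endo_def bracket_def scale_right_diff_distrib)

abbreviation f :: "'w \<Rightarrow> 'w" where "f x \<equiv> Q (Q x)"

lemmas endo_simps = endo_rules[OF endo_basic(1)] endo_rules[OF endo_basic(2)] endo_rules[OF endo_basic(3)]

lemma weight_bracket_e:
  assumes F: "endo F" "\<And>x. x \<in> W \<Longrightarrow> h (F x) = F (h x) + sc r (F x)" and x: "x \<in> W"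
  shows "h (bracket e F x) = bracket e F (h x) + sc (r + 2) (bracket e F x)"
  using x F(1) by (simp add: bracket_def endo_simps endo_rules h_e F(2) scale_left_distrib
      scale_right_diff_distrib algebra_simps)

lemma f_e: "x \<in> W \<Longrightarrow> f (e x) = e (f x) - h x"
  by (simp add: e_QQ)

text \<open>The Jacobi identity for \<open>[f, [e, F]]\<close>, where \<open>[f, e] = - h\<close>, r
  is the weight of \<open>F\<close>, and \<open>G\<close> stands for \<open>[f, F]\<close>.\<close>

lemma f_bracket_e:
  assumes F: "endo F" "\<And>x. x \<in> W \<Longrightarrow> h (F x) = F (h x) + sc r (F x)"
    and G: "endo G" "\<And>x. x \<in> W \<Longrightarrow> f (F x) = F (f x) + G x" and x: "x \<in> W"
  shows "f (bracket e F x) = bracket e F (f x) - sc r (F x) + bracket e G x"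
  using x F(1) G(1)
  by (simp add: bracket_def endo_simps endo_rules f_e F(2) G(2))

section \<open>Vanishing of \<open>[e, P]\<close> by weights\<close>

definition P :: "'w \<Rightarrow> 'w" where "P = bracket e Q"

text \<open>\<open>ad_e_P k\<close> is \<open>(ad e)\<^sup>k\<^sup>+\<^sup>1 P\<close>, of weight \<open>3 + 2k\<close>; applying \<open>ad f\<close> goes one step back, up to a nonzero factor.\<close>

primrec ad_e_P :: "nat \<Rightarrow> 'w \<Rightarrow> 'w" where
  "ad_e_P 0 = bracket e P"
| "ad_e_P (Suc k) = bracket e (ad_e_P k)"

lemma endo_P: "endo P"
  by (simp add: P_def endo_bracket endo_basic)

lemma endo_ad_e_P: "endo (ad_e_P k)"
  by (induction k) (simp_all add: endo_bracket endo_basic endo_P)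

lemma h_P: "x \<in> W \<Longrightarrow> h (P x) = P (h x) + P x"
  using weight_bracket_e[OF endo_basic(3), of "-1" x] by (simp add: h_Q P_def)

lemma h_ad_e_P: "x \<in> W \<Longrightarrow> h (ad_e_P k x) = ad_e_P k (h x) + sc (of_nat (3 + 2 * k)) (ad_e_P k x)"
proof (induction k arbitrary: x)
  case 0
  then show ?case using weight_bracket_e[OF endo_P, of 1 x] by (simp add: h_P)
next
  case (Suc k)
  show ?case
    using weight_bracket_e[OF endo_ad_e_P Suc.IH Suc.prems] by (simp add: algebra_simps)
qed

lemma endo_0: "endo (\<lambda>x. 0)"
  by (simp add: endo_def)

text \<open>\<open>Q\<close> commutes with its own square, so only the weight term of
  \<open>Q\<close> survives in the Jacobi identity, with factor -(-1) = 1.\<close>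

lemma f_P: "x \<in> W \<Longrightarrow> f (P x) = P (f x) + Q x"
  using f_bracket_e[OF endo_basic(3) _ endo_0, of "-1" x] by (simp add: h_Q P_def bracket_def endo_simps)

text \<open>The weight term - P cancels \<open>[e, Q] = P\<close>. Thus \<open>[e, P]\<close> is a
  lowest weight vector of weight 3 for the adjoint action. The summand 0 is the value of
  \<open>G\<close> when \<open>f_bracket_e\<close> is applied next.\<close>

lemma f_ad_e_P_0: "x \<in> W \<Longrightarrow> f (ad_e_P 0 x) = ad_e_P 0 (f x) + 0"
  using f_bracket_e[OF endo_P _ endo_basic(3), of 1 x] by (simp add: h_P f_P flip: P_def)

text \<open>Each bracket with \<open>e\<close> contributes the weight of the operator below it, and
  3 + 5 + ... + (3 + 2k) = (k + 1)(k + 3).\<close>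

lemma f_ad_e_P_Suc:
  "x \<in> W \<Longrightarrow> f (ad_e_P (Suc k) x) = ad_e_P (Suc k) (f x) + sc (- of_nat (Suc k * (k + 3))) (ad_e_P k x)"
proof (induction k arbitrary: x)
  case 0
  then show ?case
    using f_bracket_e[OF endo_ad_e_P h_ad_e_P endo_0 f_ad_e_P_0, of x]
    by (simp add: bracket_def[of e "\<lambda>x. 0"] endo_simps)
next
  case (Suc k)
  let ?c = "of_nat (Suc k * (k + 3)) :: complex"
  have G: "endo (\<lambda>x. sc (- ?c) (ad_e_P k x))"
    using endo_ad_e_P by (simp add: endo_def scale_right_distrib mult.commute)
  have "f (ad_e_P (Suc (Suc k)) x) = ad_e_P (Suc (Suc k)) (f x) - sc (of_nat (3 + 2 * Suc k)) (ad_e_P (Suc k) x) +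
      bracket e (\<lambda>x. sc (- ?c) (ad_e_P k x)) x"
    unfolding ad_e_P.simps(2)[of "Suc k"] by (rule f_bracket_e[OF endo_ad_e_P h_ad_e_P G Suc.IH Suc.prems])
  moreover have "bracket e (\<lambda>x. sc (- ?c) (ad_e_P k x)) x = sc (- ?c) (ad_e_P (Suc k) x)"
    using Suc.prems endo_rules[OF endo_ad_e_P] by (simp add: bracket_def endo_simps scale_right_diff_distrib)
  moreover have "(- of_nat (Suc (Suc k) * (Suc k + 3)) :: complex) = - of_nat (3 + 2 * Suc k) + - ?c"
    by (simp add: algebra_simps)
  ultimately show ?case
    by (simp only: scale_left_distrib scale_minus_left diff_conv_add_uminus add.assoc)
qed

text \<open>On a vector of weight at least -M the image has weight above M, so it is zero. The
  kernel is a subspace, so vanishing on the spanning weight vectors suffices.\<close>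

lemma ad_e_P_eventually_0:
  assumes k: "3 + 2 * real k > 2 * M" and x: "x \<in> W"
  shows "ad_e_P k x = 0"
proof -
  have "ad_e_P k w = 0" if w: "w \<in> W" "r \<ge> - M" "h w = sc (of_real r) w" for w r
  proof (rule weights_le)
    show "ad_e_P k w \<in> W" by (rule endo_rules(1)[OF endo_ad_e_P w(1)])
    show "h (ad_e_P k w) = sc (of_real (r + (3 + 2 * real k))) (ad_e_P k w)"
      using h_ad_e_P[OF w(1), of k] w(1) by (simp add: w(3) endo_rules[OF endo_ad_e_P] flip: scale_left_distrib)
    show "r + (3 + 2 * real k) > M" using k w(2) by simp
  qed
  then have "{w \<in> W. \<exists>r\<ge>-M. h w = sc (of_real r) w} \<subseteq> {w \<in> W. ad_e_P k w = 0}" by blast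
  moreover have "subspace {w \<in> W. ad_e_P k w = 0}"
    by (rule subspaceI) (simp_all add: endo_rules[OF endo_ad_e_P])
  ultimately have "span {w \<in> W. \<exists>r\<ge>-M. h w = sc (of_real r) w} \<subseteq> {w \<in> W. ad_e_P k w = 0}"
    by (rule span_minimal)
  then show ?thesis using weights_ge x by blast
qed

lemma ad_e_P_0: "x \<in> W \<Longrightarrow> ad_e_P 0 x = 0"
proof -
  obtain N :: nat where N: "2 * M < real N" using reals_Archimedean2 by blast
  \<comment> \<open>Descending induction from N: if level k + 1 vanishes on all of \<open>W\<close>,
    its bracket with \<open>f\<close> does too, and that is a nonzero multiple of level k.\<close>
  have "\<forall>x\<in>W. ad_e_P (N - j) x = 0" if "j \<le> N" for j
    using that
  proof (induction j)
    case 0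
    then show ?case using N by (auto intro!: ad_e_P_eventually_0)
  next
    case (Suc j)
    define k where "k = N - Suc j"
    have k: "N - j = Suc k" using Suc.prems by (simp add: k_def)
    have zero: "ad_e_P (Suc k) x = 0" if "x \<in> W" for x
      using Suc that unfolding k by simp
    have "ad_e_P k x = 0" if x: "x \<in> W" for x
    proof -
      have "sc (- of_nat (Suc k * (k + 3))) (ad_e_P k x) = 0"
        using f_ad_e_P_Suc[OF x, of k] zero[OF x] zero[of "f x"] x by (simp del: ad_e_P.simps add: endo_simps)
      moreover have "(of_nat (Suc k * (k + 3)) :: complex) \<noteq> 0"
        by (simp only: of_nat_eq_0_iff) simp
      ultimately show ?thesis unfolding scale_eq_0_iff neg_equal_0_iff_equal by blast
    qed
    then show ?case by (simp add: k_def)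
  qed
  from this[of N] show "x \<in> W \<Longrightarrow> ad_e_P 0 x = 0" by simp
qed

section \<open>Relations between the odd operators\<close>

lemma e_P: "x \<in> W \<Longrightarrow> e (P x) = P (e x)"
  using ad_e_P_0[of x] by (simp add: bracket_def)

lemma e_Q: "e (Q x) = Q (e x) + P x"
  by (simp add: P_def bracket_def)

text \<open>Bracketing with \<open>e\<close> is a derivation, so \<open>[e, Q Q]\<close>, which is
  \<open>h\<close>, equals PQ + QP.\<close>

lemma P_Q: "x \<in> W \<Longrightarrow> P (Q x) = h x - Q (P x)"
  using e_QQ[of x] by (simp add: e_Q endo_simps endo_rules[OF endo_P] algebra_simps)

text \<open>Bracket PQ + QP = h with \<open>e\<close>: since \<open>e\<close> commutes with
  \<open>P\<close> and \<open>[e, Q] = P\<close>, the left side becomes 2PP, and the right side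
  becomes -2e.\<close>

lemma P_P: "x \<in> W \<Longrightarrow> P (P x) = - e x"
proof -
  assume x: "x \<in> W"
  have "e (P (Q x)) = P (e (Q x))" using x by (simp add: e_P)
  then have "e (h x) - P (P x) = h (e x) + P (P x)"
    using x by (simp add: P_Q e_Q e_P endo_simps endo_rules[OF endo_P] algebra_simps)
  then have "sc 2 (e x) + (P (P x) + P (P x)) = 0"
    using x by (simp add: h_e algebra_simps)
  then have "sc 2 (e x + P (P x)) = 0"
    using scale_left_distrib[of 1 1 "P (P x)"] by (simp add: scale_right_distrib)
  then show ?thesis by (simp add: eq_neg_iff_add_eq_0 add.commute)
qed

section \<open>Normal ordering and the action of matrices\<close>

lemma h_e': "x \<in> W \<Longrightarrow> h (e x) = e (h x) + (e x + e x)"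
  using scale_left_distrib[of 1 1 "e x"] by (simp add: h_e)

text \<open>Rewriting in the spirit of Poincare-Birkhoff-Witt: words in the operators are brought
  into the order Q, P, e, h with at most one \<open>P\<close>, after which bracket relations are
  comparisons of coefficients.\<close>

lemmas pbw = h_Q h_e' h_P e_Q e_P P_Q P_P

text \<open>The five entries are the coordinates of a matrix in osp(1|2) with respect to the
  standard generators; they determine all its other entries. Reading them off makes the action
  linear in the matrix.\<close>

definition rep :: "complex ^ 3 ^ 3 \<Rightarrow> 'w \<Rightarrow> 'w" where
  "rep Y x = sc (Y $ 2 $ 3) (e x) + sc (Y $ 3 $ 2) (f x) + sc (Y $ 2 $ 2) (h x) +
     sc (Y $ 2 $ 1) (P x) + sc (Y $ 3 $ 1) (Q x)"

lemma endo_rep: "endo (rep Y)"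
  unfolding endo_def rep_def
  by (simp add: endo_simps endo_rules[OF endo_P] scale_right_distrib algebra_simps)

lemma rep_generators:
  "rep osp_e x = e x" "rep osp_f x = f x" "rep osp_h x = h x"
  "rep osp_q_plus x = P x" "rep osp_q_minus x = Q x"
  by (simp_all add: rep_def osp_e_def osp_f_def osp_h_def osp_q_plus_def osp_q_minus_def matrix_unit_def)

lemma rep_even: "rep (\<chi> i j. a * osp_e $ i $ j + b * osp_f $ i $ j + c * osp_h $ i $ j) x =
    sc a (e x) + sc b (f x) + sc c (h x)"
  by (simp add: rep_def osp_e_def osp_f_def osp_h_def matrix_unit_def)

lemma rep_odd: "rep (\<chi> i j. a * osp_q_plus $ i $ j + b * osp_q_minus $ i $ j) x = sc a (P x) + sc b (Q x)"
  by (simp add: rep_def osp_q_plus_def osp_q_minus_def matrix_unit_def)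

lemmas superbracket_simps = superbracket_def matrix_matrix_mult_def matrix_unit_def
    osp_e_def osp_f_def osp_h_def osp_q_plus_def osp_q_minus_def sum_3

lemma rep_superbracket:
  assumes X: "X \<in> osp12 q" and Y: "Y \<in> osp12 r" and q: "q \<in> {0, 1}" and r: "r \<in> {0, 1}" and x: "x \<in> W"
  shows "rep (superbracket q r X Y) x = rep X (rep Y x) - sc ((-1) ^ (q * r)) (rep Y (rep X x))"
proof -
  note ring = scale_right_distrib scale_right_diff_distrib scale_left_distrib scale_left_diff_distrib
  note rules = x pbw endo_simps endo_rules[OF endo_P]
  consider "q = 0" "r = 0" | "q = 0" "r = 1" | "q = 1" "r = 0" | "q = 1" "r = 1"
    using q r by auto
  then show ?thesis
  proof cases
    case 1
    obtain a b c where X: "X = (\<chi> i j. a * osp_e $ i $ j + b * osp_f $ i $ j + c * osp_h $ i $ j)"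
      using X 1 osp12_even_span by auto
    obtain a' b' c' where Y: "Y = (\<chi> i j. a' * osp_e $ i $ j + b' * osp_f $ i $ j + c' * osp_h $ i $ j)"
      using Y 1 osp12_even_span by auto
    \<comment> \<open>The factors 2 in \<open>[h, e]\<close> and \<open>[h, f]\<close> are spelled
      out as repeated summands, to match the normal form of the other side.\<close>
    have "rep (superbracket 0 0 X Y) x = sc (c * a') (e x) - sc (a * c') (e x) - (sc (c' * a) (e x) - sc (a' * c) (e x)) +
        (sc (b * c') (f x) - sc (c * b') (f x) - (sc (b' * c) (f x) - sc (c' * b) (f x))) + sc (a * b' - a' * b) (h x)"
      unfolding rep_def X Y scale_left_diff_distrib[symmetric] by (simp add: superbracket_simps algebra_simps)
    then show ?thesis
      unfolding 1 X Y rep_even by (simp add: rules ring) (simp add: algebra_simps)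
  next
    case 2
    obtain a b c where X: "X = (\<chi> i j. a * osp_e $ i $ j + b * osp_f $ i $ j + c * osp_h $ i $ j)"
      using X 2 osp12_even_span by auto
    obtain a' b' where Y: "Y = (\<chi> i j. a' * osp_q_plus $ i $ j + b' * osp_q_minus $ i $ j)"
      using Y 2 osp12_odd_span by auto
    have "rep (superbracket 0 1 X Y) x = sc (a * b' + c * a') (P x) + sc (b * a' - c * b') (Q x)"
      unfolding rep_def X Y by (simp add: superbracket_simps algebra_simps)
    then show ?thesis
      unfolding 2 X Y rep_even rep_odd by (simp add: rules ring) (simp add: algebra_simps)
  next
    case 3
    obtain a b c where Y: "Y = (\<chi> i j. a * osp_e $ i $ j + b * osp_f $ i $ j + c * osp_h $ i $ j)"
      using Y 3 osp12_even_span by auto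
    obtain a' b' where X: "X = (\<chi> i j. a' * osp_q_plus $ i $ j + b' * osp_q_minus $ i $ j)"
      using X 3 osp12_odd_span by auto
    have "rep (superbracket 1 0 X Y) x = sc (- (a * b' + c * a')) (P x) + sc (- (b * a' - c * b')) (Q x)"
      unfolding rep_def X Y by (simp add: superbracket_simps algebra_simps)
    then show ?thesis
      unfolding 3 X Y rep_even rep_odd by (simp add: rules ring) (simp add: algebra_simps)
  next
    case 4
    obtain a b where X: "X = (\<chi> i j. a * osp_q_plus $ i $ j + b * osp_q_minus $ i $ j)"
      using X 4 osp12_odd_span by auto
    obtain a' b' where Y: "Y = (\<chi> i j. a' * osp_q_plus $ i $ j + b' * osp_q_minus $ i $ j)"
      using Y 4 osp12_odd_span by auto
    have "rep (superbracket 1 1 X Y) x = sc (- (a * a')) (e x) - sc (a' * a) (e x) +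
        (sc (b * b') (f x) + sc (b' * b) (f x)) + sc (a * b' + a' * b) (h x)"
      unfolding rep_def X Y scale_left_diff_distrib[symmetric] scale_left_distrib[of "b * b'", symmetric]
      by (simp add: superbracket_simps algebra_simps)
    then show ?thesis
      unfolding 4 X Y rep_odd by (simp add: rules ring) (simp add: algebra_simps)
  qed
qed

theorem osp12_representation_rep:
  assumes V: "\<And>r. r \<in> {0, 1} \<Longrightarrow> subspace (V r)" "\<And>r. r \<in> {0, 1} \<Longrightarrow> V r \<subseteq> W"
    and parity: "\<And>r x. r \<in> {0, 1} \<Longrightarrow> x \<in> V r \<Longrightarrow> e x \<in> V r"
      "\<And>r x. r \<in> {0, 1} \<Longrightarrow> x \<in> V r \<Longrightarrow> h x \<in> V r"
      "\<And>r x. r \<in> {0, 1} \<Longrightarrow> x \<in> V r \<Longrightarrow> Q x \<in> V ((1 + r) mod 2)"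
  shows "osp12_representation sc V rep"
proof -
  have VW: "u \<in> W" if "u \<in> super_total V" for u
    using that V(2)[of 0] V(2)[of 1] by (auto simp: super_total_def subset_iff)
  have maps: "rep X u \<in> V ((q + r) mod 2)"
    if qr: "q \<in> {0, 1}" "r \<in> {0, 1}" and X: "X \<in> osp12 q" and u: "u \<in> V r" for q r X u
  proof -
    let ?s = "(1 + r) mod 2"
    have s: "?s \<in> {0, 1}" by auto
    have r: "(1 + ?s) mod 2 = r" using qr(2) by auto
    have Qu: "Q u \<in> V ?s" by (rule parity(3)[OF qr(2) u])
    have fu: "f u \<in> V r" using parity(3)[OF s Qu] unfolding r .
    have eu: "e u \<in> V r" "h u \<in> V r" using parity(1,2)[OF qr(2) u] by auto
    have Pu: "P u \<in> V ?s"
      unfolding P_def bracket_def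
      by (intro subspace_diff[OF V(1)[OF s]] parity(1)[OF s Qu] parity(3)[OF qr(2) eu(1)])
    show ?thesis
    proof (cases "q = 0")
      case True
      then obtain a b c where X: "X = (\<chi> i j. a * osp_e $ i $ j + b * osp_f $ i $ j + c * osp_h $ i $ j)"
        using X osp12_even_span by auto
      have "rep X u \<in> V r"
        unfolding X rep_even using eu fu V(1)[OF qr(2)] by (simp add: subspace_add subspace_scale)
      then show ?thesis using True qr(2) by auto
    next
      case False
      then have q: "q = 1" using qr(1) by simp
      then obtain a b where X: "X = (\<chi> i j. a * osp_q_plus $ i $ j + b * osp_q_minus $ i $ j)"
        using X osp12_odd_span by auto
      show ?thesis
        unfolding X rep_odd q using Pu Qu V(1)[OF s] by (simp add: subspace_add subspace_scale)
    qed
  qed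
  show ?thesis
    unfolding osp12_representation_def
  proof (intro conjI ballI allI, goal_cases)
    case 1 then show ?case by (simp add: VW endo_rules[OF endo_rep])
  next
    case 2 then show ?case by (simp add: VW endo_rules[OF endo_rep])
  next
    case 3 show ?case by (simp add: rep_def scale_left_distrib algebra_simps)
  next
    case 4 show ?case by (simp add: rep_def scale_right_distrib)
  next
    case 5 then show ?case by (intro maps)
  next
    case 6 then show ?case by (intro rep_superbracket VW)
  qed
qed

end

section \<open>Twisted forms\<close>

lemma scaleC_zero_left [simp]: "0 *\<^sub>C (x::'a::complex_vector) = 0"
  using scaleR_scaleC[of 0 x] by simp

lemma scaleC_zero_right [simp]: "z *\<^sub>C (0::'a::complex_vector) = 0"
  using scaleC_add_right[of z "0::'a" 0] by simp

lemma scaleC_one [simp]: "1 *\<^sub>C (x::'a::complex_vector) = x"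
  using scaleR_scaleC[of 1 x] by simp

lemma scaleC_scaleR_commute: "z *\<^sub>C (r *\<^sub>R x) = r *\<^sub>R (z *\<^sub>C (x::'a::complex_vector))"
  by (simp add: scaleR_scaleC scaleC_scaleC mult.commute)

lemma scaleC_sum_right: "z *\<^sub>C (\<Sum>i\<in>I. u i) = (\<Sum>i\<in>I. z *\<^sub>C (u i :: 'a::complex_vector))"
  by (induction I rule: infinite_finite_induct) (simp_all add: scaleC_add_right)

lemma scale_form_of_real: "scale_form (of_real r) \<psi> = (\<lambda>p vs. r *\<^sub>R \<psi> p vs)"
  by (simp add: scale_form_def scaleR_scaleC)

interpretation forms: vector_space "scale_form :: complex \<Rightarrow> ('m, 'n, 'f::complex_vector) form \<Rightarrow> _"
  by unfold_locales (simp_all add: scale_form_def fun_eq_iff scaleC_add_right scaleC_add_left scaleC_scaleC)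

lemma alternating_at_scaleC:
  assumes "alternating_at A p f"
  shows "alternating_at A p (\<lambda>vs. z *\<^sub>C f vs)"
proof (rule alternating_atI, goal_cases)
  case (4 vs i j)
  then show ?case using alternating_at_repeat[OF assms, of i vs j] by simp
qed (simp_all add: alternating_at_outside[OF assms] alternating_at_addD[OF assms]
    alternating_at_scaleD[OF assms] scaleC_add_right scaleC_scaleR_commute)

text \<open>The behaviour of \<open>D\<close> with respect to degrees is given for homogeneous forms
  only; mixed forms are reached by adding up such parts.\<close>

definition degree_part :: "nat \<Rightarrow> ('m, 'n, 'v::zero) form \<Rightarrow> ('m, 'n, 'v) form" where
  "degree_part k \<psi> = (\<lambda>p vs. if length vs = k then \<psi> p vs else 0)"

definition truncation :: "nat \<Rightarrow> ('m, 'n, 'v::zero) form \<Rightarrow> ('m, 'n, 'v) form" where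
  "truncation N \<psi> = (\<lambda>p vs. if length vs < N then \<psi> p vs else 0)"

lemma truncation_Suc:
  fixes \<psi> :: "('m, 'n, 'v::ab_group_add) form"
  shows "truncation (Suc N) \<psi> = truncation N \<psi> + degree_part N \<psi>"
  by (auto simp: truncation_def degree_part_def fun_eq_iff less_Suc_eq)

lemma Lambda_op_length_scaleR:
  "Lambda_op A \<omega> (\<lambda>p vs. r (length vs) *\<^sub>R \<psi> p vs) p vs = r (length vs + 2) *\<^sub>R Lambda_op A \<omega> \<psi> p vs"
  unfolding Lambda_op_def interior_product_def Let_def scaleR_sum_right scaleR_scaleR
  by (simp add: ac_simps)

lemma Lambda_op_scale: "Lambda_op A \<omega> (scale_form z \<psi>) = scale_form z (Lambda_op A \<omega> \<psi>)"
  by (simp add: Lambda_op_def interior_product_def Let_def scale_form_def scaleC_sum_right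
      scaleC_scaleR_commute)

lemma Lambda_op_add: "Lambda_op A \<omega> (\<psi> + \<phi>) = Lambda_op A \<omega> \<psi> + Lambda_op A \<omega> \<phi>"
  by (simp add: Lambda_op_def interior_product_def Let_def fun_eq_iff sum.distrib scaleR_add_right)

section \<open>Smooth twisted forms of a prequantum system and the action of \<Lambda> on
  them\<close>

locale prequantum =
  fixes m :: nat and A :: "('m::t2_space, 'n::finite) chart set" and \<omega> :: "('m, 'n, real) form"
    and E :: "'m \<Rightarrow> 'f::complex_vector set" and T :: "('m, 'f) trivialization set"
    and h :: "'m \<Rightarrow> 'f \<Rightarrow> 'f \<Rightarrow> complex" and nabla :: "('m \<Rightarrow> 'f) \<Rightarrow> ('m, 'n, 'f) form"
    and D :: "('m, 'n, 'f) form \<Rightarrow> ('m, 'n, 'f) form"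
  assumes prequantum: "prequantum_system m A \<omega> E T h nabla D"

sublocale prequantum \<subseteq> symplectic_atlas A \<omega>
  using prequantum unfolding prequantum_system_def by unfold_locales (elim conjE, assumption)+

context prequantum
begin

abbreviation W :: "('m, 'n, 'f) form set" where "W \<equiv> twisted_forms A E T"

lemma dimension: "CARD('n) = 2 * m"
  using prequantum unfolding prequantum_system_def by (elim conjE)

lemma line_bundle: "complex_line_bundle A E T"
  using prequantum unfolding prequantum_system_def by (elim conjE)

lemma fibre_closed:
  shows "u \<in> E p \<Longrightarrow> w \<in> E p \<Longrightarrow> u + w \<in> E p" "u \<in> E p \<Longrightarrow> z *\<^sub>C u \<in> E p"
    "u \<in> E p \<Longrightarrow> r *\<^sub>R u \<in> E p" "0 \<in> E p"
proof -
  obtain b where b: "E p = range (\<lambda>z. z *\<^sub>C b)"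
    using line_bundle[unfolded complex_line_bundle_def, THEN conjunct1, rule_format, of p] by blast
  show "u \<in> E p \<Longrightarrow> w \<in> E p \<Longrightarrow> u + w \<in> E p"
    unfolding b by (auto simp: scaleC_add_left[symmetric])
  show scaleC: "u \<in> E p \<Longrightarrow> z *\<^sub>C u \<in> E p" for z
    unfolding b by (auto simp: scaleC_scaleC)
  show "u \<in> E p \<Longrightarrow> r *\<^sub>R u \<in> E p"
    using scaleC by (simp add: scaleR_scaleC)
  show "0 \<in> E p" unfolding b by (rule range_eqI[where x = 0]) simp
qed

lemma fibre_sum: "(\<And>i. i \<in> I \<Longrightarrow> u i \<in> E p) \<Longrightarrow> (\<Sum>i\<in>I. u i) \<in> E p"
  by (induction I rule: infinite_finite_induct) (simp_all add: fibre_closed)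

lemmas trivialization = line_bundle[unfolded complex_line_bundle_def, THEN conjunct2, THEN conjunct2,
  THEN conjunct1, rule_format]

lemma open_trivialization: "t \<in> T \<Longrightarrow> open (fst t)"
  by (rule trivialization[THEN conjunct1])

lemma trivialization_linear:
  assumes "t \<in> T" "p \<in> fst t" "u \<in> E p"
  shows "w \<in> E p \<Longrightarrow> snd t p (u + w) = snd t p u + snd t p w"
    "snd t p (z *\<^sub>C u) = z * snd t p u"
    "snd t p (r *\<^sub>R u) = r *\<^sub>R snd t p u"
proof -
  show "w \<in> E p \<Longrightarrow> snd t p (u + w) = snd t p u + snd t p w"
    and scaleC: "snd t p (z *\<^sub>C u) = z * snd t p u" for z
    using trivialization[OF assms(1), THEN conjunct2, rule_format, OF assms(2)] assms(3) by blast+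
  show "snd t p (r *\<^sub>R u) = r *\<^sub>R snd t p u"
    using scaleC by (simp add: scaleR_scaleC scaleR_conv_of_real)
qed

lemma trivialization_0: "t \<in> T \<Longrightarrow> p \<in> fst t \<Longrightarrow> snd t p 0 = 0"
  using trivialization_linear(3)[of t p 0 0] by (simp add: fibre_closed)

lemma trivialization_sum:
  assumes "t \<in> T" "p \<in> fst t"
  shows "(\<And>i. i \<in> I \<Longrightarrow> u i \<in> E p) \<Longrightarrow> snd t p (\<Sum>i\<in>I. u i) = (\<Sum>i\<in>I. snd t p (u i))"
  by (induction I rule: infinite_finite_induct)
    (simp_all add: trivialization_0[OF assms] trivialization_linear[OF assms] fibre_sum)

lemma smooth_in_chart_cong:
  assumes "c \<in> A" "open V" "\<And>p. p \<in> fst c \<Longrightarrow> p \<in> V \<Longrightarrow> F p = G p"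
  shows "smooth_on (snd c ` (fst c \<inter> V)) (F \<circ> chart_inv c) \<longleftrightarrow>
    smooth_on (snd c ` (fst c \<inter> V)) (\<lambda>x. G (chart_inv c x))"
  using assms by (intro smooth_on_cong open_chart_image) auto

lemma twistedD:
  assumes "\<psi> \<in> W"
  shows "\<psi> p vs \<in> E p" "alternating_at A p (\<psi> p)"
    "t \<in> T \<Longrightarrow> c \<in> A \<Longrightarrow> smooth_on (snd c ` (fst c \<inter> fst t))
      (\<lambda>x. snd t (chart_inv c x) (\<psi> (chart_inv c x) (map (\<lambda>e. coord_vector A c e (chart_inv c x)) es)))"
proof -
  have \<psi>: "\<forall>p vs. \<psi> p vs \<in> E p" "\<forall>p. alternating_at A p (\<psi> p)"
    "\<forall>t\<in>T. smooth_form_on A (fst t) (\<lambda>p vs. snd t p (\<psi> p vs))"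
    using assms by (simp_all add: twisted_forms_def)
  show "\<psi> p vs \<in> E p" "alternating_at A p (\<psi> p)" using \<psi>(1,2) by simp_all
  show "smooth_on (snd c ` (fst c \<inter> fst t)) (\<lambda>x. snd t (chart_inv c x)
      (\<psi> (chart_inv c x) (map (\<lambda>e. coord_vector A c e (chart_inv c x)) es)))" if "t \<in> T" "c \<in> A"
    using \<psi>(3)[rule_format, OF that(1), unfolded smooth_form_on_def comp_def, rule_format, OF that(2)] .
qed

text \<open>\<open>G\<close> is the local expression in a chart and a trivialization. It has to
  match on the overlap of their domains only, because a trivialization is linear on the fibres just
  over its own domain.\<close>

lemma twistedI:
  assumes "\<And>p vs. \<psi> p vs \<in> E p" "\<And>p. alternating_at A p (\<psi> p)"
    and "\<And>t c es p. t \<in> T \<Longrightarrow> c \<in> A \<Longrightarrow> p \<in> fst c \<Longrightarrow> p \<in> fst t \<Longrightarrow>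
      snd t p (\<psi> p (map (\<lambda>e. coord_vector A c e p) es)) = G t c es p"
    and "\<And>t c es. t \<in> T \<Longrightarrow> c \<in> A \<Longrightarrow>
      smooth_on (snd c ` (fst c \<inter> fst t)) (\<lambda>x. G t c es (chart_inv c x))"
  shows "\<psi> \<in> W"
  unfolding twisted_forms_def smooth_form_on_def
proof (intro CollectI conjI allI ballI)
  fix t c es assume tc: "t \<in> T" "c \<in> A"
  show "smooth_on (snd c ` (fst c \<inter> fst t))
      ((\<lambda>p. snd t p (\<psi> p (map (\<lambda>e. coord_vector A c e p) es))) \<circ> chart_inv c)"
    by (subst smooth_in_chart_cong[OF tc(2) open_trivialization[OF tc(1)] assms(3)[OF tc]])
      (simp_all add: assms(4)[OF tc])
qed (simp_all add: assms)

lemma twisted_scale_length: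
  assumes "\<psi> \<in> W"
  shows "(\<lambda>p vs. r (length vs) *\<^sub>R \<psi> p vs) \<in> W"
  by (rule twistedI[where G = "\<lambda>t c es p. r (length es) *\<^sub>R snd t p (\<psi> p (map (\<lambda>e. coord_vector A c e p) es))"])
    (simp_all add: twistedD[OF assms] fibre_closed alternating_at_length_scaleR trivialization_linear
      smooth_on_scaleR smooth_on_const open_chart_image open_trivialization)

lemma twisted_add:
  assumes "\<psi> \<in> W" "\<phi> \<in> W"
  shows "\<psi> + \<phi> \<in> W"
  by (rule twistedI[where G = "\<lambda>t c es p. snd t p (\<psi> p (map (\<lambda>e. coord_vector A c e p) es)) +
        snd t p (\<phi> p (map (\<lambda>e. coord_vector A c e p) es))"])
    (simp_all add: twistedD[OF assms(1)] twistedD[OF assms(2)] fibre_closed alternating_at_add plus_fun_def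
      trivialization_linear
      smooth_on_add open_chart_image open_trivialization)

lemma twisted_scale:
  assumes "\<psi> \<in> W"
  shows "scale_form z \<psi> \<in> W"
  unfolding scale_form_def
  by (rule twistedI[where G = "\<lambda>t c es p. z * snd t p (\<psi> p (map (\<lambda>e. coord_vector A c e p) es))"])
    (simp_all add: twistedD[OF assms] fibre_closed alternating_at_scaleC trivialization_linear
      smooth_on_mult smooth_on_const open_chart_image open_trivialization)

lemma twisted_0: "0 \<in> W"
  by (rule twistedI[where G = "\<lambda>t c es p. 0"])
    (simp_all add: zero_fun_def fibre_closed alternating_at_zero trivialization_0 smooth_on_const)

lemma subspace_twisted: "forms.subspace W"
  by (rule forms.subspaceI) (simp_all add: twisted_0 twisted_add twisted_scale)

lemma twisted_degree_part: "\<psi> \<in> W \<Longrightarrow> degree_part k \<psi> \<in> W"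
  using twisted_scale_length[of \<psi> "\<lambda>l. if l = k then 1 else 0"]
  by (simp add: degree_part_def if_distrib[of "\<lambda>r. r *\<^sub>R _"] cong: if_cong)

lemma twisted_truncation: "\<psi> \<in> W \<Longrightarrow> truncation N \<psi> \<in> W"
  using twisted_scale_length[of \<psi> "\<lambda>l. if l < N then 1 else 0"]
  by (simp add: truncation_def if_distrib[of "\<lambda>r. r *\<^sub>R _"] cong: if_cong)

lemma twisted_above_dimension: "\<psi> \<in> W \<Longrightarrow> length vs > 2 * m \<Longrightarrow> \<psi> p vs = 0"
  using alternating_above_dimension[OF twistedD(2)] dimension by metis

lemma truncation_above_dimension: "\<psi> \<in> W \<Longrightarrow> truncation (Suc (2 * m)) \<psi> = \<psi>"
  by (auto simp: truncation_def fun_eq_iff twisted_above_dimension)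

lemma smooth_omega_matrix_inv:
  assumes "c \<in> A" "open V"
  shows "smooth_on (snd c ` (fst c \<inter> V)) (\<lambda>x. matrix_inv (omega_matrix A \<omega> c (chart_inv c x)) $ i $ j)"
proof (rule smooth_on_matrix_inv)
  show "open (snd c ` (fst c \<inter> V))" by (rule open_chart_image[OF assms])
  show "invertible (omega_matrix A \<omega> c (chart_inv c x))" if "x \<in> snd c ` (fst c \<inter> V)" for x
    using that invertible_omega_matrix[OF assms(1)] assms(1) by auto
  fix i j
  have "smooth_form_on A UNIV \<omega>"
    using symplectic by (simp add: symplectic_form_def forms_def)
  then have "smooth_on (snd c ` (fst c \<inter> UNIV))
      ((\<lambda>p. \<omega> p (map (\<lambda>e. coord_vector A c e p) [axis i 1, axis j 1])) \<circ> chart_inv c)"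
    using assms(1) unfolding smooth_form_on_def by blast
  then have "smooth_on (snd c ` fst c) (\<lambda>x. omega_matrix A \<omega> c (chart_inv c x) $ i $ j)"
    by (simp add: omega_matrix_def comp_def)
  then show "smooth_on (snd c ` (fst c \<inter> V)) (\<lambda>x. omega_matrix A \<omega> c (chart_inv c x) $ i $ j)"
    by (rule smooth_on_subset) auto
qed

lemma Lambda_op_in_chart:
  assumes "\<psi> \<in> W" "c \<in> A" "p \<in> fst c"
  shows "Lambda_op A \<omega> \<psi> p vs = Lambda_chart \<omega> c p (\<psi> p) vs"
  unfolding Lambda_op_eq
  using Lambda_chart_independent[OF twistedD(2)[OF assms(1)]] chart_at assms by blast

text \<open>In a fixed chart the coefficients are finite sums of entries of the inverse matrix times
  coefficients of \<psi> with two further frame vectors as arguments, all of them smooth.\<close>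

lemma twisted_Lambda:
  assumes "\<psi> \<in> W"
  shows "Lambda_op A \<omega> \<psi> \<in> W"
proof (rule twistedI[where G = "\<lambda>t c es p. (1/2) *\<^sub>R (\<Sum>i\<in>UNIV. \<Sum>j\<in>UNIV.
      matrix_inv (omega_matrix A \<omega> c p) $ i $ j *\<^sub>R
        snd t p (\<psi> p (map (\<lambda>e. coord_vector A c e p) (axis j 1 # axis i 1 # es))))"])
  fix p vs
  show "Lambda_op A \<omega> \<psi> p vs \<in> E p"
    unfolding Lambda_op_eq Lambda_chart_def
    by (intro fibre_closed fibre_sum twistedD[OF assms])
  show "alternating_at A p (Lambda_op A \<omega> \<psi> p)"
    using alternating_Lambda_chart[OF twistedD(2)[OF assms]] chart_at
    by (simp add: Lambda_op_eq[abs_def])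
next
  fix t c es p assume tp: "t \<in> T" "c \<in> A" "p \<in> fst c" "p \<in> fst t"
  show "snd t p (Lambda_op A \<omega> \<psi> p (map (\<lambda>e. coord_vector A c e p) es)) = (1/2) *\<^sub>R (\<Sum>i\<in>UNIV. \<Sum>j\<in>UNIV.
      matrix_inv (omega_matrix A \<omega> c p) $ i $ j *\<^sub>R
        snd t p (\<psi> p (map (\<lambda>e. coord_vector A c e p) (axis j 1 # axis i 1 # es))))"
    using tp by (simp add: Lambda_op_in_chart[OF assms] Lambda_chart_def trivialization_linear
        trivialization_sum fibre_closed fibre_sum twistedD(1)[OF assms])
next
  fix t c es assume "t \<in> T" "c \<in> A"
  then show "smooth_on (snd c ` (fst c \<inter> fst t)) (\<lambda>x. (1/2) *\<^sub>R (\<Sum>i\<in>UNIV. \<Sum>j\<in>UNIV.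
      matrix_inv (omega_matrix A \<omega> c (chart_inv c x)) $ i $ j *\<^sub>R snd t (chart_inv c x) (\<psi> (chart_inv c x)
        (map (\<lambda>e. coord_vector A c e (chart_inv c x)) (axis j 1 # axis i 1 # es)))))"
    by (intro smooth_on_scaleR smooth_on_const smooth_on_sum smooth_omega_matrix_inv
        twistedD(3)[OF assms] open_chart_image open_trivialization)
qed

section \<open>Degree and commutators of the induced operator\<close>

lemma induced: "induced_operator A E T nabla D"
  using prequantum unfolding prequantum_system_def by (elim conjE)

lemma D_degree: "\<psi> \<in> W \<Longrightarrow> D (degree_part k \<psi>) \<in> W"
  "\<psi> \<in> W \<Longrightarrow> length vs \<noteq> Suc k \<Longrightarrow> D (degree_part k \<psi>) p vs = 0"
proof -
  assume \<psi>: "\<psi> \<in> W"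
  have "degree_part k \<psi> \<in> W \<inter> of_degree k"
    using twisted_degree_part[OF \<psi>] by (simp add: of_degree_def degree_part_def)
  then have "D (degree_part k \<psi>) \<in> W \<inter> of_degree (Suc k)"
    using induced unfolding induced_operator_def by blast
  then show "D (degree_part k \<psi>) \<in> W" "length vs \<noteq> Suc k \<Longrightarrow> D (degree_part k \<psi>) p vs = 0"
    by (auto simp: of_degree_def)
qed

lemma D_add: "\<psi> \<in> W \<Longrightarrow> \<phi> \<in> W \<Longrightarrow> D (\<psi> + \<phi>) = D \<psi> + D \<phi>"
  using induced unfolding induced_operator_def by blast

lemma D_scale: "\<psi> \<in> W \<Longrightarrow> D (scale_form z \<psi>) = scale_form z (D \<psi>)"
  using induced unfolding induced_operator_def by blast

lemma D_0: "D 0 = 0"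
  using D_scale[OF twisted_0, of 0] by simp

text \<open>Additivity of \<open>D\<close> admits one homogeneous part at a time. The part of degree
  k - 1 alone contributes in degree k; the empty list is set apart because natural subtraction would
  give 0 - 1 = 0.\<close>

lemma D_truncation:
  assumes "\<psi> \<in> W"
  shows "D (truncation N \<psi>) \<in> W \<and> (\<forall>p vs. D (truncation N \<psi>) p vs =
    (if vs \<noteq> [] \<and> length vs \<le> N then D (degree_part (length vs - 1) \<psi>) p vs else 0))"
proof (induction N)
  case 0
  show ?case
    by (simp add: truncation_def D_0[unfolded zero_fun_def] twisted_0[unfolded zero_fun_def])
next
  case (Suc N)
  have "D (truncation (Suc N) \<psi>) = D (truncation N \<psi>) + D (degree_part N \<psi>)"
    unfolding truncation_Suc by (intro D_add twisted_truncation twisted_degree_part assms)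
  note D_Suc = this
  have "D (truncation (Suc N) \<psi>) \<in> W"
    unfolding D_Suc by (intro twisted_add conjunct1[OF Suc] D_degree(1) assms)
  moreover have "D (truncation (Suc N) \<psi>) p vs =
      (if vs \<noteq> [] \<and> length vs \<le> Suc N then D (degree_part (length vs - 1) \<psi>) p vs else 0)" for p vs
    unfolding D_Suc plus_fun_apply Suc[THEN conjunct2, rule_format]
    using D_degree(2)[OF assms] by (auto simp: le_Suc_eq)
  ultimately show ?case by blast
qed

lemma twisted_D: "\<psi> \<in> W \<Longrightarrow> D \<psi> \<in> W"
  using D_truncation[of \<psi> "Suc (2 * m)"] by (simp add: truncation_above_dimension)

text \<open>A form equals its truncation to degrees up to 2m, which settles degrees up to 2m + 1; in
  higher ones both sides vanish by dimension.\<close>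

lemma D_eq:
  assumes "\<psi> \<in> W"
  shows "D \<psi> p vs = (if vs = [] then 0 else D (degree_part (length vs - 1) \<psi>) p vs)"
proof (cases "length vs \<le> Suc (2 * m)")
  case True
  then show ?thesis
    using D_truncation[OF assms, of "Suc (2 * m)"] by (simp add: truncation_above_dimension[OF assms])
next
  case False
  then show ?thesis
    using twisted_above_dimension[OF twisted_D[OF assms], of vs p]
      twisted_above_dimension[OF D_degree(1)[OF assms], of vs] by simp
qed

lemma twisted_H: "\<psi> \<in> W \<Longrightarrow> H_op m \<psi> \<in> W"
  unfolding H_op_def by (rule twisted_scale_length)

lemma D_D: "\<psi> \<in> W \<Longrightarrow> D (D \<psi>) = scale_form (- \<i>) (L_op \<omega> \<psi>)"
  using prequantum unfolding prequantum_system_def by (elim conjE) (drule (1) bspec)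

lemma H_D:
  assumes "\<psi> \<in> W"
  shows "H_op m (D \<psi>) = D (H_op m \<psi>) - D \<psi>"
proof (intro ext)
  fix p vs
  show "H_op m (D \<psi>) p vs = (D (H_op m \<psi>) - D \<psi>) p vs"
  proof (cases "vs = []")
    case True
    then show ?thesis by (simp add: H_op_def D_eq[OF assms] D_eq[OF twisted_H[OF assms], unfolded H_op_def])
  next
    case False
    \<comment> \<open>This is the degree of the part that \<open>D\<close> moves to the degree of
      \<open>vs\<close>; on it \<open>H_op\<close> is a scalar, which passes through
      \<open>D\<close>.\<close>
    define k where "k = length vs - 1"
    have k: "length vs = Suc k" using False by (simp add: k_def)
    define r where "r = real m - real k"
    have part: "degree_part k (H_op m \<psi>) = scale_form (of_real r) (degree_part k \<psi>)"
      unfolding scale_form_of_real by (auto simp: degree_part_def H_op_def fun_eq_iff r_def)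
    have "D (degree_part k (H_op m \<psi>)) = scale_form (of_real r) (D (degree_part k \<psi>))"
      unfolding part by (rule D_scale[OF twisted_degree_part[OF assms]])
    then have "D (H_op m \<psi>) p vs = r *\<^sub>R D \<psi> p vs"
      unfolding D_eq[OF assms, of p vs] D_eq[OF twisted_H[OF assms], of p vs] k_def[symmetric]
      using False by (simp add: scale_form_of_real)
    then show ?thesis by (simp add: H_op_def k r_def algebra_simps)
  qed
qed

lemma H_Lambda: "H_op m (Lambda_op A \<omega> \<psi>) = Lambda_op A \<omega> (H_op m \<psi>) + scale_form 2 (Lambda_op A \<omega> \<psi>)"
proof (intro ext)
  fix p vs
  have "Lambda_op A \<omega> (H_op m \<psi>) p vs = (real m - real (length vs + 2)) *\<^sub>R Lambda_op A \<omega> \<psi> p vs"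
    unfolding H_op_def by (rule Lambda_op_length_scaleR[where r = "\<lambda>l. real m - real l"])
  moreover have "scale_form 2 (Lambda_op A \<omega> \<psi>) p vs = 2 *\<^sub>R Lambda_op A \<omega> \<psi> p vs"
    using scale_form_of_real[of 2 "Lambda_op A \<omega> \<psi>"] by simp
  ultimately show "H_op m (Lambda_op A \<omega> \<psi>) p vs =
      (Lambda_op A \<omega> (H_op m \<psi>) + scale_form 2 (Lambda_op A \<omega> \<psi>)) p vs"
    by (simp add: H_op_def flip: scaleR_add_left)
qed

lemma Lambda_L:
  assumes "\<psi> \<in> W"
  shows "Lambda_op A \<omega> (L_op \<omega> \<psi>) = L_op \<omega> (Lambda_op A \<omega> \<psi>) + H_op m \<psi>"
proof (intro ext)
  fix p vs
  show "Lambda_op A \<omega> (L_op \<omega> \<psi>) p vs = (L_op \<omega> (Lambda_op A \<omega> \<psi>) + H_op m \<psi>) p vs"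
    using Lambda_wedge_omega[where p = p and \<psi> = \<psi> and vs = vs, OF twistedD(2)[OF assms]] dimension
    by (simp add: L_op_def H_op_def)
qed

end

theorem theorem1:
  fixes A :: "('m::t2_space, 'n::finite) chart set"
    and \<omega> :: "('m, 'n, real) form"
    and E :: "'m \<Rightarrow> 'f::complex_vector set"
    and T :: "('m, 'f) trivialization set"
    and h :: "'m \<Rightarrow> 'f \<Rightarrow> 'f \<Rightarrow> complex"
    and nabla :: "('m \<Rightarrow> 'f) \<Rightarrow> ('m, 'n, 'f) form"
    and D :: "('m, 'n, 'f) form \<Rightarrow> ('m, 'n, 'f) form"
    and m :: nat
  assumes "prequantum_system m A \<omega> E T h nabla D"
  shows "\<exists>\<rho> a b. a \<noteq> 0 \<and> b \<noteq> 0 \<and>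
    osp12_representation scale_form (twisted_forms_super A E T) \<rho> \<and>
    (\<forall>\<psi>\<in>twisted_forms A E T.
       \<rho> osp_e \<psi> = Lambda_op A \<omega> \<psi> \<and>
       \<rho> osp_f \<psi> = L_op \<omega> \<psi> \<and>
       \<rho> osp_h \<psi> = H_op m \<psi> \<and>
       \<rho> osp_q_plus \<psi> = scale_form a (nabla_Lambda A \<omega> D \<psi>) \<and>
       \<rho> osp_q_minus \<psi> = scale_form b (D \<psi>))"
proof -
  interpret prequantum m A \<omega> E T h nabla D by unfold_locales (rule assms)
  define b where "b = csqrt \<i>"
  have b: "b * b = \<i>"
    unfolding b_def power2_eq_square[symmetric] by (rule power2_csqrt)
  then have b0: "b \<noteq> 0" by auto
  define Q where "Q \<psi> = scale_form b (D \<psi>)" for \<psi>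
  have QQ: "Q (Q \<psi>) = L_op \<omega> \<psi>" if "\<psi> \<in> W" for \<psi>
    using that b by (simp add: Q_def D_scale twisted_D D_D mult.assoc[symmetric])
  interpret osp: osp_triple scale_form W "Lambda_op A \<omega>" "H_op m" Q "real m"
  proof
    show "forms.subspace W" by (rule subspace_twisted)
    fix \<psi> \<phi> z assume \<psi>: "\<psi> \<in> W"
    show "Lambda_op A \<omega> \<psi> \<in> W" "H_op m \<psi> \<in> W" "Q \<psi> \<in> W"
      using \<psi> by (simp_all add: twisted_Lambda twisted_H Q_def twisted_scale twisted_D)
    show "Lambda_op A \<omega> (\<psi> + \<phi>) = Lambda_op A \<omega> \<psi> + Lambda_op A \<omega> \<phi>"
      by (rule Lambda_op_add)
    show "H_op m (\<psi> + \<phi>) = H_op m \<psi> + H_op m \<phi>"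
      by (simp add: H_op_def fun_eq_iff scaleR_add_right)
    show "Q (\<psi> + \<phi>) = Q \<psi> + Q \<phi>" if "\<phi> \<in> W"
      using \<psi> that by (simp add: Q_def D_add forms.scale_right_distrib)
    show "Lambda_op A \<omega> (scale_form z \<psi>) = scale_form z (Lambda_op A \<omega> \<psi>)"
      by (rule Lambda_op_scale)
    show "H_op m (scale_form z \<psi>) = scale_form z (H_op m \<psi>)"
      by (simp add: H_op_def scale_form_def scaleC_scaleR_commute)
    show "Q (scale_form z \<psi>) = scale_form z (Q \<psi>)"
      using \<psi> by (simp add: Q_def D_scale mult.commute)
    show "H_op m (Lambda_op A \<omega> \<psi>) = Lambda_op A \<omega> (H_op m \<psi>) + scale_form 2 (Lambda_op A \<omega> \<psi>)"
      by (rule H_Lambda)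
    have "H_op m (Q \<psi>) = scale_form b (H_op m (D \<psi>))"
      by (simp add: Q_def H_op_def scale_form_def scaleC_scaleR_commute)
    then show "H_op m (Q \<psi>) = Q (H_op m \<psi>) - Q \<psi>"
      using \<psi> by (simp add: Q_def H_D forms.scale_right_diff_distrib)
    show "Lambda_op A \<omega> (Q (Q \<psi>)) = Q (Q (Lambda_op A \<omega> \<psi>)) + H_op m \<psi>"
      using \<psi> by (simp add: QQ Lambda_L twisted_Lambda)
    \<comment> \<open>Degrees are nonnegative, so no eigenvalue m - k exceeds m.\<close>
    show "\<psi> = 0" if H: "H_op m \<psi> = scale_form (of_real r) \<psi>" and r: "r > real m" for r
    proof (intro ext)
      fix p vs
      have "(real m - real (length vs)) *\<^sub>R \<psi> p vs = r *\<^sub>R \<psi> p vs"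
        using fun_cong[OF fun_cong[OF H, of p], of vs] by (simp add: H_op_def scale_form_def scaleR_scaleC)
      then show "\<psi> p vs = 0 p vs" using r by (auto simp: scaleR_right_imp_eq)
    qed
  next
    \<comment> \<open>Degrees end at 2m, where the weight is -m, so every form is a finite sum of
      homogeneous parts with weights at least -m.\<close>
    let ?S = "{\<phi> \<in> W. \<exists>r\<ge>- real m. H_op m \<phi> = scale_form (of_real r) \<phi>}"
    show "W \<subseteq> forms.span ?S"
    proof
      fix \<psi> assume \<psi>: "\<psi> \<in> W"
      have "truncation N \<psi> \<in> forms.span ?S" if "N \<le> Suc (2 * m)" for N
        using that
      proof (induction N)
        case 0
        show ?case by (simp add: truncation_def forms.span_zero[unfolded zero_fun_def])
      next
        case (Suc N)
        have "H_op m (degree_part N \<psi>) = scale_form (of_real (real m - real N)) (degree_part N \<psi>)"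
          unfolding scale_form_of_real by (auto simp: degree_part_def H_op_def fun_eq_iff)
        moreover have "real m - real N \<ge> - real m" using Suc.prems by simp
        ultimately have part: "degree_part N \<psi> \<in> ?S" using twisted_degree_part[OF \<psi>] by blast
        have "truncation N \<psi> \<in> forms.span ?S" using Suc by simp
        then show ?case
          unfolding truncation_Suc by (rule forms.span_add[OF _ forms.span_base[OF part]])
      qed
      from this[of "Suc (2 * m)"] show "\<psi> \<in> forms.span ?S"
        by (simp add: truncation_above_dimension[OF \<psi>])
    qed
  qed
  have rep: "osp12_representation scale_form (twisted_forms_super A E T) osp.rep"
  proof (rule osp.osp12_representation_rep)
    fix r :: nat
    show "forms.subspace (twisted_forms_super A E T r)"
      by (rule forms.subspaceI)
        (auto simp: twisted_forms_super_def twisted_0 twisted_add twisted_scale[unfolded scale_form_def] scale_form_def)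
    show "twisted_forms_super A E T r \<subseteq> W" by (auto simp: twisted_forms_super_def)
  next
    fix r :: nat and \<psi> assume r: "r \<in> {0, 1}" and \<psi>: "\<psi> \<in> twisted_forms_super A E T r"
    then have W: "\<psi> \<in> W" and van: "\<And>p vs. length vs mod 2 \<noteq> r \<Longrightarrow> \<psi> p vs = 0"
      by (auto simp: twisted_forms_super_def)
    show "Lambda_op A \<omega> \<psi> \<in> twisted_forms_super A E T r"
      using twisted_Lambda[OF W] by (simp add: twisted_forms_super_def Lambda_op_eq Lambda_chart_def van)
    show "H_op m \<psi> \<in> twisted_forms_super A E T r"
      using twisted_H[OF W] by (simp add: twisted_forms_super_def H_op_def van)
    have "D \<psi> p vs = 0" if "length vs mod 2 \<noteq> (1 + r) mod 2" for p vs
    proof (cases "vs = []")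
      case False
      then have "(length vs - 1) mod 2 \<noteq> r" using that by (cases vs) (auto, presburger)
      then have "degree_part (length vs - 1) \<psi> = 0"
        by (auto simp: degree_part_def fun_eq_iff van)
      then show ?thesis using False by (simp add: D_eq[OF W, of p vs] D_0)
    qed (simp add: D_eq[OF W])
    then show "Q \<psi> \<in> twisted_forms_super A E T ((1 + r) mod 2)"
      using twisted_scale[OF twisted_D[OF W]] by (simp add: twisted_forms_super_def Q_def scale_form_def)
  qed
  \<comment> \<open>The sign, and with it the witness a = - b, reflects the order of the brackets:
    \<open>P\<close> is \<open>[\<Lambda>, Q]\<close>, whereas \<open>nabla_Lambda\<close> has
    \<Lambda> in the second place.\<close>
  have P: "osp.P \<psi> = scale_form (- b) (nabla_Lambda A \<omega> D \<psi>)" for \<psi>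
    by (simp add: osp.P_def osp.bracket_def Q_def nabla_Lambda_def Lambda_op_scale
        forms.scale_right_diff_distrib)
  show ?thesis
    using rep b0
    by (intro exI[of _ osp.rep] exI[of _ "- b"] exI[of _ b])
      (simp add: osp.rep_generators QQ P Q_def[symmetric])
qed

end
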